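(* Let $\mathbb{F}$ be an algebraically closed field of characteristic $p\ge 0$ and let $A$ be an infinite (countable) dimensional simple locally finite associative algebra over $\mathbb{F}$. Then $A$ has a perfect local system of arbitrarily large rank; that is, for every positive integer $N$ there is a perfect local system $\{A_\alpha\}_{\alpha\in\Gamma}$ of $A$ such that the rank of $A_\alpha$ is at least $N$ for every $\alpha\in\Gamma$.
   Context: Algebras are associative and not required to have an identity element; ideals are two-sided. An algebra $A$ over $\mathbb{F}$ is locally finite if every finite set of elements of $A$ is contained in a finite dimensional subalgebra of $A$. A local system for $A$ is a system $\{A_\alpha\}_{\alpha\in\Gamma}$ of finite dimensional subalgebras of $A$ such that $A=\bigcup_{\alpha\in\Gamma}A_\alpha$ and for all $\alpha,\beta\in\Gamma$ there is $\gamma\in\Gamma$ with $A_\alpha,A_\beta\subseteq A_\gamma$. An algebra $B$ is perfect if $BB=B$, where $BB$ is the linear span of all products of two elements of $B$. A local system is perfect if each of its members is a perfect algebra. For a finite dimensional algebra $B$, $\operatorname{rad}B$ denotes its (nilpotent) radical. The rank of a perfect finite dimensional algebra $B$ is the smallest rank of the simple components of the semisimple algebra $B/\operatorname{rad}B$, where each simple component is isomorphic to a matrix algebra $M_n(\mathbb{F})$ and the rank of $M_n(\mathbb{F})$ is $n$. *)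

theory Defs
  imports
    "HOL-Library.Countable_Set"
    "HOL-Computational_Algebra.Polynomial"
    "Jordan_Normal_Form.Matrix"
begin

text \<open>
  Algebras with explicit carriers, not required to have an identity. Subalgebras, their quotients
  and matrix algebras live on different carriers, so ideals, simplicity and isomorphism are
  defined for such records.
\<close>

record ('f, 'b) alg_struct =
  acarrier :: "'b set"
  azero :: 'b
  aadd :: "'b \<Rightarrow> 'b \<Rightarrow> 'b"
  amult :: "'b \<Rightarrow> 'b \<Rightarrow> 'b"
  ascale :: "'f \<Rightarrow> 'b \<Rightarrow> 'b"

definition alg_ideal :: "('f, 'b) alg_struct \<Rightarrow> 'b set \<Rightarrow> bool" where
  "alg_ideal G I \<longleftrightarrow>
     I \<subseteq> acarrier G \<and> azero G \<in> I \<and>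
     (\<forall>x\<in>I. \<forall>y\<in>I. aadd G x y \<in> I) \<and>
     (\<forall>c. \<forall>x\<in>I. ascale G c x \<in> I) \<and>
     (\<forall>a\<in>acarrier G. \<forall>x\<in>I. amult G a x \<in> I \<and> amult G x a \<in> I)"

definition simple_alg :: "('f, 'b) alg_struct \<Rightarrow> bool" where
  "simple_alg G \<longleftrightarrow>
     (\<exists>x\<in>acarrier G. \<exists>y\<in>acarrier G. amult G x y \<noteq> azero G) \<and>
     (\<forall>I. alg_ideal G I \<longrightarrow> I = {azero G} \<or> I = acarrier G)"

definition alg_iso :: "('f, 'b) alg_struct \<Rightarrow> ('f, 'c) alg_struct \<Rightarrow> bool" where
  "alg_iso G H \<longleftrightarrow>
     (\<exists>\<phi>. bij_betw \<phi> (acarrier G) (acarrier H) \<and>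
        (\<forall>x\<in>acarrier G. \<forall>y\<in>acarrier G.
           \<phi> (aadd G x y) = aadd H (\<phi> x) (\<phi> y) \<and>
           \<phi> (amult G x y) = amult H (\<phi> x) (\<phi> y)) \<and>
        (\<forall>c. \<forall>x\<in>acarrier G. \<phi> (ascale G c x) = ascale H c (\<phi> x)))"

definition alg_coset :: "('f, 'b) alg_struct \<Rightarrow> 'b set \<Rightarrow> 'b \<Rightarrow> 'b set" where
  "alg_coset G I x = aadd G x ` I"

text \<open>
  The operations on cosets do not depend on representatives when \<open>I\<close> is an ideal, so each union
  below is a single coset.
\<close>

definition alg_quotient :: "('f, 'b) alg_struct \<Rightarrow> 'b set \<Rightarrow> ('f, 'b set) alg_struct" where
  "alg_quotient G I =
     \<lparr> acarrier = alg_coset G I ` acarrier G,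
       azero = I,
       aadd = (\<lambda>X Y. \<Union>x\<in>X. \<Union>y\<in>Y. alg_coset G I (aadd G x y)),
       amult = (\<lambda>X Y. \<Union>x\<in>X. \<Union>y\<in>Y. alg_coset G I (amult G x y)),
       ascale = (\<lambda>c X. \<Union>x\<in>X. alg_coset G I (ascale G c x)) \<rparr>"

definition matrix_alg :: "nat \<Rightarrow> ('f :: field, 'f mat) alg_struct" where
  "matrix_alg n =
     \<lparr> acarrier = carrier_mat n n, azero = 0\<^sub>m n n, aadd = (+), amult = (*), ascale = (\<cdot>\<^sub>m) \<rparr>"

text \<open>
  The simple components of a semisimple algebra are the ideals that are simple as algebras.
\<close>

definition simple_component :: "('f, 'b) alg_struct \<Rightarrow> 'b set \<Rightarrow> bool" where
  "simple_component G C \<longleftrightarrow> alg_ideal G C \<and> simple_alg (G\<lparr>acarrier := C\<rparr>)"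

definition component_ranks :: "('f :: field, 'b) alg_struct \<Rightarrow> nat set" where
  "component_ranks G =
     {n. \<exists>C. simple_component G C \<and> alg_iso (G\<lparr>acarrier := C\<rparr>) (matrix_alg n)}"

text \<open>
  An associative algebra whose carrier is the whole type \<open>'a\<close>; the class \<open>ring\<close> does not
  provide an identity element.
\<close>

locale assoc_algebra = vector_space scale
  for scale :: "'f :: field \<Rightarrow> 'a :: ring \<Rightarrow> 'a" +
  assumes scale_mult_left: "scale c (x * y) = scale c x * y"
    and scale_mult_right: "scale c (x * y) = x * scale c y"
begin

definition alg_on :: "'a set \<Rightarrow> ('f, 'a) alg_struct" where
  "alg_on B = \<lparr> acarrier = B, azero = 0, aadd = (+), amult = (*), ascale = scale \<rparr>"

definition subalgebra :: "'a set \<Rightarrow> bool" where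
  "subalgebra B \<longleftrightarrow> subspace B \<and> (\<forall>x\<in>B. \<forall>y\<in>B. x * y \<in> B)"

definition fin_dim :: "'a set \<Rightarrow> bool" where
  "fin_dim B \<longleftrightarrow> (\<exists>S. finite S \<and> span S = B)"

definition countably_infinite_dim :: bool where
  "countably_infinite_dim \<longleftrightarrow>
     (\<exists>E. independent E \<and> span E = UNIV \<and> infinite E \<and> countable E)"

definition locally_finite :: bool where
  "locally_finite \<longleftrightarrow> (\<forall>S. finite S \<longrightarrow> (\<exists>B. subalgebra B \<and> fin_dim B \<and> S \<subseteq> B))"

definition product_span :: "'a set \<Rightarrow> 'a set \<Rightarrow> 'a set" where
  "product_span X Y = span {x * y | x y. x \<in> X \<and> y \<in> Y}"

definition perfect :: "'a set \<Rightarrow> bool" where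
  "perfect B \<longleftrightarrow> product_span B B = B"

text \<open>The exponent is shifted: \<open>subspace_power I n\<close> is spanned by the products of \<open>n + 1\<close> factors.\<close>

primrec subspace_power :: "'a set \<Rightarrow> nat \<Rightarrow> 'a set" where
  "subspace_power I 0 = I"
| "subspace_power I (Suc n) = product_span I (subspace_power I n)"

definition nilpotent :: "'a set \<Rightarrow> bool" where
  "nilpotent I \<longleftrightarrow> (\<exists>n. subspace_power I n = {0})"

text \<open>
  The sum of all nilpotent ideals of \<open>B\<close>. When \<open>B\<close> is finite dimensional, this is the largest
  nilpotent ideal.
\<close>

definition radical :: "'a set \<Rightarrow> 'a set" where
  "radical B = span (\<Union>{I. alg_ideal (alg_on B) I \<and> nilpotent I})"

text \<open>
  The smallest rank of a simple component of \<open>B\<close> modulo its radical. There is no such component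
  only when \<open>B\<close> is zero (for perfect finite dimensional \<open>B\<close>, over an algebraically closed field);
  its rank is then set to \<open>0\<close>, so a lower bound \<open>N \<ge> 1\<close> on the rank excludes the zero algebra.
\<close>

definition alg_rank :: "'a set \<Rightarrow> nat" where
  "alg_rank B =
     (let R = component_ranks (alg_quotient (alg_on B) (radical B))
      in if R = {} then 0 else (LEAST n. n \<in> R))"

text \<open>A local system is represented by the set of its members.\<close>

definition local_system :: "'a set set \<Rightarrow> bool" where
  "local_system \<S> \<longleftrightarrow>
     (\<forall>B\<in>\<S>. subalgebra B \<and> fin_dim B) \<and> \<Union>\<S> = UNIV \<and>
     (\<forall>B\<in>\<S>. \<forall>C\<in>\<S>. \<exists>D\<in>\<S>. B \<subseteq> D \<and> C \<subseteq> D)"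

definition perfect_local_system :: "'a set set \<Rightarrow> bool" where
  "perfect_local_system \<S> \<longleftrightarrow> local_system \<S> \<and> (\<forall>B\<in>\<S>. perfect B)"

end

end

theory Submission
  imports Defs "Jordan_Normal_Form.Determinant"
begin

text \<open>
  A simple algebra is generated as an ideal by each of its nonzero idempotents. Suppose \<open>A\<close> contains
  orthogonal idempotents \<open>e\<^sub>1, \<dots>, e\<^sub>N\<close>. Given a finite subset of \<open>A\<close>, take a finite dimensional
  subalgebra \<open>M\<close> large enough that the \<open>M e\<^sub>i M\<close> all contain this set and all the \<open>e\<^sub>j\<close>. Then
  \<open>P = M e\<^sub>1 M\<close> is perfect because \<open>e\<^sub>1\<close> is idempotent, and no \<open>e\<^sub>i\<close> vanishes in a simple
  component of \<open>P / rad P\<close>, which therefore has rank at least \<open>N\<close>.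

  Such idempotents exist: a finite dimensional algebra without nonzero idempotents is nilpotent, which
  gives a first idempotent. Given a finite orthogonal family with sum \<open>f\<close> and a member \<open>e\<close>, either
  \<open>e\<close> splits, or \<open>e A e\<close> consists of the multiples of \<open>e\<close>. In the latter case \<open>f\<close> is not an
  identity, for otherwise \<open>A = f A f\<close> would be finite dimensional, and primeness yields an idempotent
  orthogonal to \<open>f\<close>.

  A component of \<open>P / rad P\<close> that is a matrix algebra comes from a primitive idempotent \<open>e\<close> of
  \<open>P\<close>: the ideal generated by \<open>e\<close> acts on \<open>P e\<close> modulo the radical.
\<close>

section \<open>Finite dimensional subspaces and idempotents\<close>

text \<open>Without an identity element, idempotents do two jobs. They detect nilpotency: a finite
  dimensional algebra is nilpotent exactly when 0 is its only idempotent, so that an ideal lies in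
  the radical as soon as it contains no nonzero idempotent. They also act as local units:
  \<open>M\<close> need not be perfect, but \<open>M e M\<close> is, because e = eee lets a factor e
  move to either side.

  Algebraic closure enters through one eigenvector, that of left multiplication on
  \<open>e P\<close>. It makes the corner \<open>e P e\<close> of a primitive e consist of the
  multiples of e, modulo the radical for a finite dimensional P and exactly in the simple algebra.

  Since \<open>alg_rank\<close> is a minimum with default 0, two separate facts are needed about P /
  rad P: a matrix algebra of size n holding N orthogonal nonzero idempotents has n at least N, which
  bounds every component, and some component is a matrix algebra, which excludes the default. The
  second fact is obtained from a pair of dual bases, extended as long as possible in the manner of
  Gram and Schmidt.\<close>

context assoc_algebra
begin

section \<open>Subspaces of least and of largest dimension\<close>

lemma fin_dim_subspace:
  assumes "fin_dim V" "subspace W" "W \<subseteq> V"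
  shows "fin_dim W"
proof -
  obtain S where S: "finite S" "span S = V"
    using assms(1) unfolding fin_dim_def by blast
  obtain B where B: "B \<subseteq> W" "independent B" "W \<subseteq> span B"
    using basis_exists[of W] by metis
  have "finite B"
    using independent_span_bound[OF S(1) B(2)] B(1) S(2) assms(3) by blast
  moreover have "span B = W"
    using B assms(2) span_minimal by blast
  ultimately show ?thesis
    unfolding fin_dim_def by blast
qed

lemma dim_psubset:
  assumes "fin_dim V" "subspace V" "subspace W" "W \<subset> V"
  shows "dim W < dim V"
proof -
  obtain S where S: "finite S" "span S = V"
    using assms(1) unfolding fin_dim_def by blast
  obtain B where B: "B \<subseteq> W" "independent B" "W \<subseteq> span B"
    using basis_exists[of W] by metis
  obtain B' where B': "B \<subseteq> B'" "B' \<subseteq> V" "independent B'" "V \<subseteq> span B'"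
    using maximal_independent_subset_extend[of B V] B assms(4) by blast
  have fin: "finite B'"
    using independent_span_bound[OF S(1) B'(3)] B' S(2) by blast
  have "span B \<subseteq> W"
    using B(1) assms(3) span_minimal by blast
  then have "B \<noteq> B'"
    using B'(4) assms(4) by auto
  then have "card B < card B'"
    using B'(1) fin by (simp add: psubset_card_mono psubsetI)
  then show ?thesis
    using B B' basis_card_eq_dim by metis
qed

text \<open>A member of least dimension stands in for the descending chain condition. Each
  minimality argument below applies this to a family of subspaces of a fixed finite dimensional
  algebra.\<close>

lemma fin_dim_minimal:
  assumes "fin_dim V" "Q W\<^sub>0" "\<And>W. Q W \<Longrightarrow> subspace W \<and> W \<subseteq> V"
  obtains W where "Q W" "\<And>W'. Q W' \<Longrightarrow> W' \<subseteq> W \<Longrightarrow> W' = W"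
proof -
  obtain W where W: "Q W" "\<And>W'. Q W' \<Longrightarrow> dim W \<le> dim W'"
    using ex_has_least_nat[of Q W\<^sub>0 dim] assms(2) by blast
  show thesis
  proof (rule that[OF W(1)], rule ccontr)
    fix W' assume W': "Q W'" "W' \<subseteq> W" "W' \<noteq> W"
    then have "dim W' < dim W"
      using dim_psubset[of W W'] fin_dim_subspace assms W(1) by blast
    with W(2) W'(1) show False by fastforce
  qed
qed

lemma dim_mono_fin_dim:
  assumes "fin_dim V" "subspace V" "subspace W" "W \<subseteq> V"
  shows "dim W \<le> dim V"
  using dim_psubset[OF assms(1-3)] assms(4) by (metis less_imp_le order_refl psubsetI)

lemma fin_dim_maximal:
  assumes "fin_dim V" "subspace V" "Q W\<^sub>0" "\<And>W. Q W \<Longrightarrow> subspace W \<and> W \<subseteq> V"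
  obtains W where "Q W" "\<And>W'. Q W' \<Longrightarrow> W \<subseteq> W' \<Longrightarrow> W' = W"
proof -
  have "\<forall>W. Q W \<longrightarrow> dim W \<le> dim V"
    using dim_mono_fin_dim assms by blast
  then obtain W where W: "Q W" "\<And>W'. Q W' \<Longrightarrow> dim W' \<le> dim W"
    using ex_has_greatest_nat[of Q W\<^sub>0 dim "Suc (dim V)"] assms(3) by (metis less_Suc_eq_le)
  show thesis
  proof (rule that[OF W(1)], rule ccontr)
    fix W' assume W': "Q W'" "W \<subseteq> W'" "W' \<noteq> W"
    then have "dim W < dim W'"
      using dim_psubset[of W' W] fin_dim_subspace assms W(1) by blast
    with W(2) W'(1) show False by fastforce
  qed
qed

section \<open>Products of subspaces\<close>

lemma module_hom_mult_left: "module_hom scale scale ((*) x)"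
  by unfold_locales (auto simp: distrib_left scale_mult_right)

lemma module_hom_mult_right: "module_hom scale scale (\<lambda>p. p * x)"
  by unfold_locales (auto simp: distrib_right scale_mult_left)

lemma subspace_mult_left: "subspace B \<Longrightarrow> subspace ((*) x ` B)"
  by (rule module_hom.subspace_image[OF module_hom_mult_left])

lemma subspace_mult_right: "subspace B \<Longrightarrow> subspace ((\<lambda>p. p * x) ` B)"
  by (rule module_hom.subspace_image[OF module_hom_mult_right])

lemma subalgebra_subspace: "subalgebra B \<Longrightarrow> subspace B"
  and subalgebra_mult: "subalgebra B \<Longrightarrow> x \<in> B \<Longrightarrow> y \<in> B \<Longrightarrow> x * y \<in> B"
  unfolding subalgebra_def by auto

lemma subspace_product_span [simp]: "subspace (product_span X Y)"
  unfolding product_span_def by simp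

lemma product_spanI: "x \<in> X \<Longrightarrow> y \<in> Y \<Longrightarrow> x * y \<in> product_span X Y"
  unfolding product_span_def by (rule span_base) blast

lemma product_span_least:
  assumes "subspace S" "\<And>x y. x \<in> X \<Longrightarrow> y \<in> Y \<Longrightarrow> x * y \<in> S"
  shows "product_span X Y \<subseteq> S"
  unfolding product_span_def using assms by (intro span_minimal) auto

lemma product_span_mono: "X \<subseteq> X' \<Longrightarrow> Y \<subseteq> Y' \<Longrightarrow> product_span X Y \<subseteq> product_span X' Y'"
  by (rule product_span_least) (auto intro: product_spanI)

lemma subspace_mult_left_preimage: "subspace S \<Longrightarrow> subspace {z. x * z \<in> S}"
  unfolding subspace_def by (auto simp: distrib_left scale_mult_right[symmetric])

lemma subspace_mult_right_preimage: "subspace S \<Longrightarrow> subspace {z. z * x \<in> S}"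
  unfolding subspace_def by (auto simp: distrib_right scale_mult_left[symmetric])

text \<open>The \<open>z\<close> that satisfy the conclusion form a subspace, the preimage of
  \<open>S\<close> under multiplication by \<open>a\<close>. This lemma and its mirror image reduce
  statements about sums of products to single products.\<close>

lemma product_span_mult_left:
  assumes "subspace S" "\<And>x y. x \<in> X \<Longrightarrow> y \<in> Y \<Longrightarrow> a * (x * y) \<in> S" "z \<in> product_span X Y"
  shows "a * z \<in> S"
  using product_span_least[OF subspace_mult_left_preimage[OF assms(1), of a], of X Y] assms by auto

lemma product_span_mult_right:
  assumes "subspace S" "\<And>x y. x \<in> X \<Longrightarrow> y \<in> Y \<Longrightarrow> (x * y) * a \<in> S" "z \<in> product_span X Y"
  shows "z * a \<in> S"
  using product_span_least[OF subspace_mult_right_preimage[OF assms(1), of a], of X Y] assms by auto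

lemma product_span_assoc:
  "product_span (product_span X Y) Z = product_span X (product_span Y Z)"
proof
  show "product_span (product_span X Y) Z \<subseteq> product_span X (product_span Y Z)"
    by (rule product_span_least, simp, rule product_span_mult_right[rotated 2], assumption)
      (auto simp: mult.assoc intro!: product_spanI)
  show "product_span X (product_span Y Z) \<subseteq> product_span (product_span X Y) Z"
    by (rule product_span_least, simp, rule product_span_mult_left[rotated 2], assumption)
      (auto simp: mult.assoc[symmetric] intro!: product_spanI)
qed

section \<open>From fixed vectors to idempotents, and the nilpotency criterion\<close>

text \<open>
  Inside the commutative double centralizer \<open>C\<close> of \<open>x\<close>, choose \<open>y\<close> fixing \<open>b\<close> with \<open>y C\<close> minimal;
  then \<open>y C = y\<^sup>2 C = \<dots>\<close>, and a solution of \<open>y\<^sup>2 = y\<^sup>2 g\<close> in \<open>y\<^sup>2 C\<close> is idempotent.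
\<close>
lemma idempotent_of_fixed_vector:
  assumes B: "subalgebra B" "fin_dim B" and x: "x \<in> B" "x * b = b" "b \<noteq> 0"
  obtains c where "c \<in> B" "x * c \<noteq> 0" "(x * c) * (x * c) = x * c"
proof -
  define C where "C = {c \<in> B. \<forall>z. z * x = x * z \<longrightarrow> z * c = c * z}"
  have sC: "subspace C"
    using subalgebra_subspace[OF B(1)] unfolding C_def subspace_def
    by (auto simp: distrib_left distrib_right scale_mult_left[symmetric] scale_mult_right[symmetric])
  have C_mult: "c * d \<in> C" if "c \<in> C" "d \<in> C" for c d
  proof -
    have "z * (c * d) = (c * d) * z" if "z * x = x * z" for z
    proof -
      have "z * (c * d) = c * (z * d)"
        using \<open>c \<in> C\<close> that unfolding C_def by (simp flip: mult.assoc)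
      then show ?thesis
        using \<open>d \<in> C\<close> that unfolding C_def by (simp add: mult.assoc)
    qed
    then show ?thesis
      using \<open>c \<in> C\<close> \<open>d \<in> C\<close> subalgebra_mult[OF B(1), of c d] unfolding C_def by blast
  qed
  have comm: "c * d = d * c" if "c \<in> C" "d \<in> C" for c d
  proof -
    have "x * c = c * x" using \<open>c \<in> C\<close> unfolding C_def by blast
    then have "c * x = x * c" by (rule sym)
    then show ?thesis using \<open>d \<in> C\<close> unfolding C_def by blast
  qed
  have xC: "x \<in> C" using x(1) unfolding C_def by blast
  define Q where "Q = (\<lambda>W. \<exists>y\<in>C. y * b = b \<and> W = (*) y ` C)"
  have Q: "subspace W \<and> W \<subseteq> B" if QW: "Q W" for W
  proof -
    obtain y where y: "y \<in> C" "W = (*) y ` C" using QW unfolding Q_def by blast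
    have "C \<subseteq> B" unfolding C_def by blast
    then show ?thesis using y sC subspace_mult_left C_mult by auto
  qed
  have "Q ((*) x ` C)" using xC x unfolding Q_def by auto
  then obtain W where W: "Q W" "\<And>W'. Q W' \<Longrightarrow> W' \<subseteq> W \<Longrightarrow> W' = W"
    using fin_dim_minimal[OF B(2), of Q] Q by metis
  then obtain y where y: "y \<in> C" "y * b = b" "W = (*) y ` C" unfolding Q_def by blast
  define s where "s = y * y"
  have s: "s \<in> C" "s * b = b" using y C_mult unfolding s_def by (auto simp: mult.assoc)
  \<comment> \<open>The factor \<open>x\<close> is what makes the idempotent found below a multiple
    of \<open>x\<close>. As \<open>x\<close> fixes \<open>b\<close>, so does \<open>w\<close>, which
    therefore still competes with \<open>y\<close> for minimality.\<close>
  define w where "w = x * (s * s)"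
  have w: "w \<in> C" "w * b = b" using s xC C_mult x unfolding w_def by (auto simp: mult.assoc)
  have "(*) w ` C \<subseteq> W"
  proof
    fix u assume "u \<in> (*) w ` C"
    then obtain c where c: "c \<in> C" "u = w * c" by auto
    have "w = (s * s) * x" unfolding w_def by (rule comm[OF xC C_mult[OF s(1) s(1)]])
    then have "w = y * (y * (s * x))" unfolding s_def by (simp only: mult.assoc)
    then have "u = y * (y * (s * x) * c)" using c by (simp add: mult.assoc)
    then show "u \<in> W" using y c s xC C_mult by auto
  qed
  then have "(*) w ` C = W" using W(2) w unfolding Q_def by blast
  moreover have "s \<in> W" using y unfolding s_def by auto
  ultimately obtain c where c: "c \<in> C" "s = w * c" by auto
  define g where "g = x * (s * c)"
  have gs: "s * g = s"
  proof -
    have "s * g = (s * x) * (s * c)" unfolding g_def by (simp only: mult.assoc)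
    also have "\<dots> = w * c"
      unfolding comm[OF s(1) xC] w_def by (simp only: mult.assoc)
    finally show ?thesis using c by simp
  qed
  have "g = (x * c) * s" unfolding g_def comm[OF s(1) c(1)] by (rule mult.assoc[symmetric])
  then have gg: "g * g = g" using gs by (simp add: mult.assoc)
  have "s \<noteq> 0" using s(2) x(3) by auto
  then have "g \<noteq> 0" using gs by auto
  moreover have "s * c \<in> B" using C_mult[OF s(1) c(1)] unfolding C_def by blast
  ultimately show thesis using that[of "s * c"] gg unfolding g_def by blast
qed

text \<open>Choose a nonzero left ideal \<open>P a\<close> of least dimension. Some \<open>b\<close>
  in it has \<open>P b\<close> nonzero, for otherwise P = PP would kill \<open>a\<close>. By
  minimality \<open>P b\<close> is all of \<open>P a\<close>, so it contains \<open>b\<close>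
  itself.\<close>

lemma perfect_fixed_vector:
  assumes P: "subalgebra P" "fin_dim P" "perfect P" "P \<noteq> {0}"
  obtains l b where "l \<in> P" "b \<in> P" "l * b = b" "b \<noteq> 0"
proof -
  have PP: "product_span P P = P" using P(3) unfolding perfect_def .
  define Q where "Q = (\<lambda>W. \<exists>a\<in>P. W = (\<lambda>p. p * a) ` P \<and> W \<noteq> {0})"
  have Q: "subspace W \<and> W \<subseteq> P" if "Q W" for W
    using that subspace_mult_right[OF subalgebra_subspace[OF P(1)]] subalgebra_mult[OF P(1)]
    unfolding Q_def by auto
  have "\<exists>a\<in>P. \<exists>p\<in>P. p * a \<noteq> 0"
  proof (rule ccontr)
    assume "\<not> ?thesis"
    then have "product_span P P \<subseteq> {0}" by (intro product_span_least) auto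
    then show False using PP P(4) subspace_0[OF subalgebra_subspace[OF P(1)]] by auto
  qed
  then obtain a\<^sub>0 where "Q ((\<lambda>p. p * a\<^sub>0) ` P)" unfolding Q_def by auto
  then obtain W where W: "Q W" "\<And>W'. Q W' \<Longrightarrow> W' \<subseteq> W \<Longrightarrow> W' = W"
    using fin_dim_minimal[OF P(2), of Q] Q by metis
  then obtain a where a: "a \<in> P" "W = (\<lambda>p. p * a) ` P" "W \<noteq> {0}" unfolding Q_def by blast
  have "\<exists>b\<in>W. \<exists>p\<in>P. p * b \<noteq> 0"
  proof (rule ccontr)
    assume neg: "\<not> ?thesis"
    have "u * a = 0" if "u \<in> P" for u
      using product_span_mult_right[of "{0}" P P a u] neg a that PP by (auto simp: mult.assoc)
    then have "W \<subseteq> {0}" using a by auto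
    then show False using a subspace_0 Q[OF W(1)] by auto
  qed
  then obtain b p where b: "b \<in> W" "p \<in> P" "p * b \<noteq> 0" by blast
  have bP: "b \<in> P" using b Q[OF W(1)] by auto
  have "Q ((\<lambda>p. p * b) ` P)" unfolding Q_def using b bP by auto
  moreover have "(\<lambda>p. p * b) ` P \<subseteq> W"
  proof (rule image_subsetI)
    fix p assume "p \<in> P"
    moreover obtain q where "q \<in> P" "b = q * a" using b(1) a(2) by blast
    ultimately show "p * b \<in> W"
      unfolding a(2) using subalgebra_mult[OF P(1)] by (auto simp: mult.assoc[symmetric])
  qed
  ultimately have "b \<in> (\<lambda>p. p * b) ` P" using W(2) b(1) by blast
  then obtain l where "l \<in> P" "l * b = b" by auto
  moreover have "b \<noteq> 0" using b by auto
  ultimately show thesis using that bP by blast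
qed

lemma subspace_subspace_power [simp]: "subspace I \<Longrightarrow> subspace (subspace_power I n)"
  by (induction n) auto

lemma subspace_power_subset: "subalgebra K \<Longrightarrow> subspace_power K n \<subseteq> K"
proof (induction n)
  case (Suc n)
  then show ?case
    unfolding subspace_power.simps
    by (intro product_span_least subalgebra_subspace) (auto intro: subalgebra_mult)
qed simp

lemma subspace_power_Suc_subset:
  "subalgebra K \<Longrightarrow> subspace_power K (Suc n) \<subseteq> subspace_power K n"
proof (induction n)
  case 0
  then show ?case using subspace_power_subset[of K 1] by simp
next
  case (Suc n)
  then have "product_span K (subspace_power K (Suc n)) \<subseteq> product_span K (subspace_power K n)"
    by (intro product_span_mono) auto
  then show ?case by simp
qed

text \<open>Exponent \<open>n\<close> stands for n + 1 factors, so the factor counts m + 1 and n + 1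
  add up to exponent m + n + 1.\<close>

lemma subspace_power_product:
  "product_span (subspace_power K m) (subspace_power K n) = subspace_power K (Suc (m + n))"
proof (induction m)
  case (Suc m)
  then show ?case by (simp add: product_span_assoc)
qed simp

text \<open>The powers of \<open>K\<close> decrease, so one of least dimension is perfect; it is
  nonzero because \<open>K\<close> is not nilpotent. A fixed vector in it yields the idempotent.
  Together with \<open>nilpotent_idempotent_zero\<close> this turns questions of nilpotency into
  questions about idempotents.\<close>

lemma nonnilpotent_idempotent:
  assumes K: "subalgebra K" "fin_dim K" "\<not> nilpotent K"
  obtains g where "g \<in> K" "g * g = g" "g \<noteq> 0"
proof -
  note sK = subalgebra_subspace[OF K(1)]
  define Q where "Q = (\<lambda>W. \<exists>n. W = subspace_power K n)"
  have Q: "subspace W \<and> W \<subseteq> K" if "Q W" for W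
    using that subspace_power_subset[OF K(1)] sK unfolding Q_def by auto
  have "Q K" unfolding Q_def by (rule exI[of _ 0]) simp
  then obtain P where P: "Q P" "\<And>W'. Q W' \<Longrightarrow> W' \<subseteq> P \<Longrightarrow> W' = P"
    using fin_dim_minimal[OF K(2), of Q] Q by metis
  then obtain n where n: "P = subspace_power K n" unfolding Q_def by blast
  have PP: "product_span P P = P"
  proof (rule P(2))
    show "Q (product_span P P)" unfolding n subspace_power_product Q_def by blast
    have "subspace_power K (m + n) \<subseteq> subspace_power K n" for m
    proof (induction m)
      case (Suc m)
      then show ?case using subspace_power_Suc_subset[OF K(1), of "m + n"] by auto
    qed simp
    from this[of "Suc n"] show "product_span P P \<subseteq> P" unfolding n subspace_power_product by simp
  qed
  have "P \<noteq> {0}" using K(3) n unfolding nilpotent_def by auto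
  moreover have sP: "subalgebra P"
    unfolding subalgebra_def using Q[OF P(1)] PP product_spanI[of _ P _ P] by auto
  moreover have fP: "fin_dim P" using fin_dim_subspace[OF K(2)] Q[OF P(1)] by auto
  ultimately obtain l b where "l \<in> P" "b \<in> P" "l * b = b" "b \<noteq> 0"
    using perfect_fixed_vector PP unfolding perfect_def by metis
  then obtain c where c: "c \<in> P" "l * c \<noteq> 0" "(l * c) * (l * c) = l * c"
    using idempotent_of_fixed_vector[OF sP fP] by metis
  moreover have "l * c \<in> K" using Q[OF P(1)] subalgebra_mult[OF sP \<open>l \<in> P\<close> c(1)] by auto
  ultimately show thesis using that by blast
qed

lemma idempotent_in_subspace_power:
  assumes "g \<in> K" "g * g = g"
  shows "g \<in> subspace_power K n"
proof (induction n)
  case (Suc n)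
  then show ?case using product_spanI[OF assms(1) Suc] assms(2) by simp
qed (use assms in simp)

lemma nilpotent_idempotent_zero:
  assumes "nilpotent K" "g \<in> K" "g * g = g"
  shows "g = 0"
  using idempotent_in_subspace_power[OF assms(2,3)] assms(1) unfolding nilpotent_def by auto

end

section \<open>Eigenvectors over an algebraically closed field\<close>

locale alg_closed_algebra = assoc_algebra scale
  for scale :: "'f :: alg_closed_field \<Rightarrow> 'a :: ring \<Rightarrow> 'a"
begin

text \<open>The vectors obtained from \<open>v\<close> by iterating \<open>T\<close> lie in the
  finite dimensional \<open>W\<close>, so some nonzero polynomial p satisfies p(T) v = 0. Removing
  one linear factor from such a p of least degree leaves an eigenvector.\<close>

lemma eigenvector_exists:
  fixes T :: "'a \<Rightarrow> 'a"
  assumes T: "\<And>x y. T (x + y) = T x + T y" "\<And>c x. T (scale c x) = scale c (T x)"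
    and W: "subspace W" "fin_dim W" "\<And>w. w \<in> W \<Longrightarrow> T w \<in> W" "v \<in> W" "v \<noteq> 0"
  obtains r b where "b \<in> W" "b \<noteq> 0" "T b = scale r b"
proof -
  have T0: "T 0 = 0" using T(2)[of 0 0] by simp
  \<comment> \<open>Horner evaluation of p(T) v.\<close>
  define act where "act = (\<lambda>p. fold_coeffs (\<lambda>a w. scale a v + T w) p 0)"
  have act_pCons: "act (pCons a p) = scale a v + T (act p)" for a p
    by (cases "p = 0"; cases "a = 0") (auto simp: act_def T0)
  have act_0: "act 0 = 0" by (simp add: act_def)
  have act_add: "act (p + q) = act p + act q" for p q
    by (induction p q rule: poly_induct2)
      (auto simp: act_pCons act_0 T algebra_simps scale_left_distrib)
  have act_smult: "act (Polynomial.smult c p) = scale c (act p)" for c p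
    by (induction p) (auto simp: act_pCons act_0 T algebra_simps scale_right_distrib)
  have act_sum: "act (\<Sum>i\<in>S. f i) = (\<Sum>i\<in>S. act (f i))" for f :: "'z \<Rightarrow> 'f poly" and S
    by (induction S rule: infinite_finite_induct) (auto simp: act_add act_0)
  have act_W: "act p \<in> W" for p
    by (induction p) (auto simp: act_pCons act_0 W subspace_0 intro!: subspace_add subspace_scale)
  have "\<exists>p. p \<noteq> 0 \<and> act p = 0"
  proof (rule ccontr)
    assume neg: "\<not> ?thesis"
    define f where "f = (\<lambda>i::nat. act (monom 1 i))"
    \<comment> \<open>Independence is a property of the set \<open>range f\<close> and does not see
      repetitions. A repetition is excluded first: it would give the annihilating polynomial X^i -
      X^j.\<close>
    have inj: "inj f"
    proof (rule injI, rule ccontr)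
      fix i j assume ij: "f i = f j" "i \<noteq> j"
      have "act (monom 1 i + Polynomial.smult (- 1) (monom 1 j)) = 0"
        using ij(1) unfolding act_add act_smult f_def by simp
      moreover have "coeff (monom 1 i + Polynomial.smult (- 1) (monom 1 j)) i = (1::'f)" using ij by simp
      ultimately show False using neg by (metis coeff_0 zero_neq_one)
    qed
    have "independent (range f)"
    proof (rule ccontr)
      assume "\<not> ?thesis"
      then obtain t u where t: "finite t" "t \<subseteq> range f" "(\<Sum>z\<in>t. scale (u z) z) = 0" "\<exists>z\<in>t. u z \<noteq> 0"
        unfolding dependent_explicit by blast
      \<comment> \<open>The linear relation among iterates of \<open>v\<close>, lifted to a
        polynomial; injectivity of \<open>f\<close> keeps its coefficients apart.\<close>
      define p where "p = (\<Sum>z\<in>t. Polynomial.smult (u z) (monom 1 (inv_into UNIV f z)))"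
      have "act p = (\<Sum>z\<in>t. scale (u z) z)"
        unfolding p_def act_sum act_smult
      proof (rule sum.cong)
        fix z assume "z \<in> t"
        then have "f (inv_into UNIV f z) = z" using t(2) by (auto simp: f_inv_into_f)
        then show "scale (u z) (act (monom 1 (inv_into UNIV f z))) = scale (u z) z"
          unfolding f_def by simp
      qed simp
      then have "p = 0" using t(3) neg by metis
      obtain z where z: "z \<in> t" "u z \<noteq> 0" using t(4) by blast
      have "coeff p (inv_into UNIV f z) = (\<Sum>z'\<in>t. if z' = z then u z' else 0)"
        unfolding p_def coeff_sum
        by (rule sum.cong) (use t(2) z inj in \<open>auto simp: subset_iff image_iff dest: inv_into_injective\<close>)
      also have "\<dots> = u z" using t(1) z by simp
      finally show False using z \<open>p = 0\<close> by simp
    qed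
    moreover have "range f \<subseteq> W" using act_W unfolding f_def by auto
    moreover obtain S where "finite S" "span S = W" using W(2) unfolding fin_dim_def by blast
    ultimately have "finite (range f)" using independent_span_bound by blast
    then show False using inj by (simp add: finite_image_iff)
  qed
  then obtain p where p: "p \<noteq> 0" "act p = 0" "\<And>q. q \<noteq> 0 \<Longrightarrow> act q = 0 \<Longrightarrow> degree p \<le> degree q"
    using ex_has_least_nat[of "\<lambda>p. p \<noteq> 0 \<and> act p = 0" _ degree] by blast
  have "degree p > 0"
  proof (rule ccontr)
    assume "\<not> ?thesis"
    then obtain a where a: "p = [:a:]" using degree_eq_zeroE by blast
    then have "scale a v = 0" using p(2) by (simp add: act_pCons act_0 T0)
    then show False using a p(1) W(5) by simp
  qed
  \<comment> \<open>With p = (X - r) q, the degree of q is too small for q(T) v to vanish, while T -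
    r sends q(T) v to p(T) v = 0.\<close>
  then obtain r where "poly p r = 0" using alg_closed_imp_poly_has_root by blast
  then obtain q where q: "p = [:- r, 1:] * q" using poly_eq_0_iff_dvd by blast
  have "q \<noteq> 0" using p(1) q by auto
  then have "degree q < degree p" unfolding q by (subst degree_mult_eq) auto
  then have "act q \<noteq> 0" using p(3) \<open>q \<noteq> 0\<close> by force
  moreover have "T (act q) = scale r (act q)"
  proof -
    have "p = Polynomial.smult (- r) q + pCons 0 q" unfolding q by simp
    then have "act p = scale (- r) (act q) + T (act q)"
      by (simp only: act_add act_smult act_pCons) simp
    then show ?thesis using p(2) by (simp add: add_eq_0_iff2)
  qed
  ultimately show thesis using that[of "act q" r] act_W by blast
qed

end

section \<open>Radical and primitive idempotents\<close>

context assoc_algebra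
begin

section \<open>The radical as the largest nilpotent ideal\<close>

lemma alg_ideal_alg_on_iff:
  "alg_ideal (alg_on B) I \<longleftrightarrow>
     I \<subseteq> B \<and> subspace I \<and> (\<forall>a\<in>B. \<forall>x\<in>I. a * x \<in> I \<and> x * a \<in> I)"
  unfolding alg_ideal_def alg_on_def subspace_def by auto

lemma alg_ideal_subalgebra: "alg_ideal (alg_on B) I \<Longrightarrow> subalgebra I"
  unfolding alg_ideal_alg_on_iff subalgebra_def by blast

text \<open>For an idempotent g = a + b of the sum, g is a power of itself and hence congruent
  modulo \<open>I'\<close> to an arbitrarily high power of a. Nilpotency of \<open>I\<close> then
  puts g into \<open>I'\<close>, where only 0 is idempotent.\<close>

lemma nilpotent_ideal_sum:
  assumes P: "subalgebra P" "fin_dim P"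
    and I: "alg_ideal (alg_on P) I" "nilpotent I" and I': "alg_ideal (alg_on P) I'" "nilpotent I'"
  defines "K \<equiv> {x + y | x y. x \<in> I \<and> y \<in> I'}"
  shows "alg_ideal (alg_on P) K" "nilpotent K"
proof -
  note Is = I(1)[unfolded alg_ideal_alg_on_iff] I'(1)[unfolded alg_ideal_alg_on_iff]
  show ideal: "alg_ideal (alg_on P) K"
    unfolding alg_ideal_alg_on_iff
  proof (intro conjI)
    show "K \<subseteq> P"
      using Is subspace_add[OF subalgebra_subspace[OF P(1)]] unfolding K_def by blast
    show "subspace K"
      using Is subspace_sums unfolding K_def by blast
    show "\<forall>a\<in>P. \<forall>x\<in>K. a * x \<in> K \<and> x * a \<in> K"
      using Is unfolding K_def by (auto simp: distrib_left distrib_right) blast+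
  qed
  show "nilpotent K"
  proof (rule ccontr)
    assume "\<not> nilpotent K"
    moreover have "fin_dim K"
      using fin_dim_subspace[OF P(2)] ideal unfolding alg_ideal_alg_on_iff by blast
    ultimately obtain g where g: "g \<in> K" "g * g = g" "g \<noteq> 0"
      using nonnilpotent_idempotent alg_ideal_subalgebra[OF ideal] by metis
    then obtain a b where ab: "a \<in> I" "b \<in> I'" "g = a + b" unfolding K_def by blast
    have gP: "g \<in> P" using g ideal unfolding alg_ideal_alg_on_iff by blast
    have "\<exists>x\<in>subspace_power I n. g - x \<in> I'" for n
    proof (induction n)
      case 0
      then show ?case using ab by (auto intro!: bexI[of _ a])
    next
      case (Suc n)
      then obtain x where x: "x \<in> subspace_power I n" "g - x \<in> I'" by blast
      have "g - a * x = b * g + a * (g - x)"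
        using g(2) ab(3) by (simp add: algebra_simps)
      moreover have "b * g \<in> I'" "a * (g - x) \<in> I'" using Is ab x gP by blast+
      ultimately have "g - a * x \<in> I'" using Is subspace_add by metis
      then show ?case using product_spanI[OF ab(1) x(1)] by auto
    qed
    moreover obtain n where "subspace_power I n = {0}" using I(2) unfolding nilpotent_def by blast
    ultimately have "g \<in> I'" by (metis diff_zero singletonD)
    then show False using nilpotent_idempotent_zero[OF I'(2) _ g(2)] g(3) by blast
  qed
qed

lemma nilpotent_ideal_subset_radical:
  "alg_ideal (alg_on P) I \<Longrightarrow> nilpotent I \<Longrightarrow> I \<subseteq> radical P"
  unfolding radical_def by (rule subset_trans[OF Union_upper span_superset]) simp

text \<open>A nilpotent ideal \<open>W\<close> of largest dimension absorbs every other one, since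
  its sum with another is again nilpotent. So the union in the definition of \<open>radical\<close>
  is already \<open>W\<close>.\<close>

lemma
  assumes P: "subalgebra P" "fin_dim P"
  shows radical_ideal: "alg_ideal (alg_on P) (radical P)"
    and radical_nilpotent: "nilpotent (radical P)"
proof -
  note sP = subalgebra_subspace[OF P(1)]
  define Q where "Q = (\<lambda>I. alg_ideal (alg_on P) I \<and> nilpotent I)"
  have "Q {0}"
    unfolding Q_def alg_ideal_alg_on_iff nilpotent_def using subspace_0[OF sP]
    by (auto intro: exI[of _ 0])
  moreover have "subspace W \<and> W \<subseteq> P" if "Q W" for W
    using that unfolding Q_def alg_ideal_alg_on_iff by blast
  ultimately obtain W where W: "Q W" "\<And>W'. Q W' \<Longrightarrow> W \<subseteq> W' \<Longrightarrow> W' = W"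
    using fin_dim_maximal[OF P(2) sP, of Q] by metis
  have "I \<subseteq> W" if "Q I" for I
  proof -
    let ?K = "{x + y | x y. x \<in> W \<and> y \<in> I}"
    have W0: "0 \<in> W" "0 \<in> I"
      using W(1) that subspace_0 unfolding Q_def alg_ideal_alg_on_iff by blast+
    have "W \<subseteq> ?K" using W0(2) by (metis (mono_tags, lifting) add.right_neutral mem_Collect_eq subsetI)
    moreover have "Q ?K"
      using nilpotent_ideal_sum[OF P, of W I] W(1) that unfolding Q_def by blast
    ultimately have "?K = W" using W(2) by blast
    moreover have "I \<subseteq> ?K" using W0(1) by (metis (mono_tags, lifting) add_0 mem_Collect_eq subsetI)
    ultimately show ?thesis by blast
  qed
  then have "\<Union>{I. alg_ideal (alg_on P) I \<and> nilpotent I} = W"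
    using W(1) unfolding Q_def by blast
  moreover have "subspace W" using W(1) unfolding Q_def alg_ideal_alg_on_iff by blast
  ultimately have "radical P = W" unfolding radical_def by simp
  then show "alg_ideal (alg_on P) (radical P)" "nilpotent (radical P)"
    using W(1) unfolding Q_def by auto
qed

text \<open>An idempotent g of \<open>I\<close> equals g g, so it lies in the radical and vanishes.
  Equivalently, P / rad P has no nonzero ideal of square zero, which is the form in which
  nondegeneracy is proved later.\<close>

lemma radical_square:
  assumes P: "subalgebra P" "fin_dim P" and I: "alg_ideal (alg_on P) I"
    and sq: "\<And>x y. x \<in> I \<Longrightarrow> y \<in> I \<Longrightarrow> x * y \<in> radical P"
  shows "I \<subseteq> radical P"
proof (rule nilpotent_ideal_subset_radical[OF I], rule ccontr)
  assume "\<not> nilpotent I"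
  moreover have "fin_dim I"
    using fin_dim_subspace[OF P(2)] I unfolding alg_ideal_alg_on_iff by blast
  ultimately obtain g where g: "g \<in> I" "g * g = g" "g \<noteq> 0"
    using nonnilpotent_idempotent alg_ideal_subalgebra[OF I] by metis
  then have "g \<in> radical P" using sq by metis
  then show False using nilpotent_idempotent_zero[OF radical_nilpotent[OF P] _ g(2)] g(3) by blast
qed

text \<open>Because \<open>K P\<close> lies in \<open>K\<close>, the k-th power of
  \<open>P K\<close> lies in \<open>P\<close> times the k-th power of \<open>K\<close>. The
  conclusion concerns \<open>P K\<close>, which without an identity need not contain
  \<open>K\<close>; an element z with e z = z is recovered as a product.\<close>

lemma nilpotent_right_ideal_radical:
  assumes P: "subalgebra P" and K: "subspace K" "K \<subseteq> P" "nilpotent K"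
    and KP: "\<And>k p. k \<in> K \<Longrightarrow> p \<in> P \<Longrightarrow> k * p \<in> K"
  shows "product_span P K \<subseteq> radical P"
proof (rule nilpotent_ideal_subset_radical)
  let ?I = "product_span P K"
  show "alg_ideal (alg_on P) ?I"
    unfolding alg_ideal_alg_on_iff
  proof (intro conjI ballI)
    show "?I \<subseteq> P"
      using K(2) subalgebra_mult[OF P] by (intro product_span_least subalgebra_subspace[OF P]) blast
    fix a x assume a: "a \<in> P" and x: "x \<in> ?I"
    show "a * x \<in> ?I"
      by (rule product_span_mult_left[OF _ _ x], simp, subst mult.assoc[symmetric])
        (auto intro: product_spanI subalgebra_mult[OF P a])
    show "x * a \<in> ?I"
      by (rule product_span_mult_right[OF _ _ x], simp, subst mult.assoc)
        (auto intro: product_spanI KP a)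
  qed simp
  have KP': "product_span K P \<subseteq> K" by (rule product_span_least) (use K KP in auto)
  have "subspace_power ?I n \<subseteq> product_span P (subspace_power K n)" for n
  proof (induction n)
    case (Suc n)
    have "subspace_power ?I (Suc n) \<subseteq> product_span ?I (product_span P (subspace_power K n))"
      using Suc by (auto intro: product_span_mono[THEN subsetD, rotated 2])
    also have "\<dots> = product_span P (product_span (product_span K P) (subspace_power K n))"
      by (simp add: product_span_assoc)
    also have "\<dots> \<subseteq> product_span P (product_span K (subspace_power K n))"
      by (intro product_span_mono KP') auto
    finally show ?case by simp
  qed simp
  moreover obtain n where "subspace_power K n = {0}" using K(3) unfolding nilpotent_def by blast
  moreover have "product_span P {0} \<subseteq> {0}" by (rule product_span_least) auto
  ultimately have "subspace_power ?I n \<subseteq> {0}" by (metis subset_trans)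
  moreover have "0 \<in> subspace_power ?I n" by (rule subspace_0) simp
  ultimately show "nilpotent ?I" unfolding nilpotent_def by blast
qed

section \<open>Primitive idempotents and their corners\<close>

definition primitive_in :: "'a set \<Rightarrow> 'a \<Rightarrow> bool" where
  "primitive_in P e \<longleftrightarrow> e \<in> P \<and> e * e = e \<and> e \<noteq> 0 \<and>
     (\<forall>h\<in>P. h * h = h \<and> e * h = h \<and> h * e = h \<longrightarrow> h = 0 \<or> h = e)"

text \<open>Take \<open>e\<close> with corner \<open>e P e\<close> of least dimension. A nonzero
  idempotent h below e has its corner inside that of e, hence equal to it; then e lies in
  \<open>h P h\<close>, which forces h = e.\<close>

lemma primitive_exists:
  assumes P: "subalgebra P" "fin_dim P" and g: "g \<in> P" "g * g = g" "g \<noteq> 0"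
  obtains e where "primitive_in P e"
proof -
  define c where "c = (\<lambda>e. (\<lambda>p. p * e) ` (*) e ` P)"
  define Q where "Q = (\<lambda>W. \<exists>e\<in>P. e * e = e \<and> e \<noteq> 0 \<and> W = c e)"
  have Q: "subspace W \<and> W \<subseteq> P" if "Q W" for W
    using that subspace_mult_right subspace_mult_left subalgebra_subspace[OF P(1)]
      subalgebra_mult[OF P(1)] unfolding Q_def c_def by auto
  have "Q (c g)" using g unfolding Q_def by blast
  then obtain W where W: "Q W" "\<And>W'. Q W' \<Longrightarrow> W' \<subseteq> W \<Longrightarrow> W' = W"
    using fin_dim_minimal[OF P(2), of Q] Q by metis
  then obtain e where e: "e \<in> P" "e * e = e" "e \<noteq> 0" "W = c e" unfolding Q_def by blast
  have "h = e" if h: "h \<in> P" "h * h = h" "e * h = h" "h * e = h" "h \<noteq> 0" for h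
  proof -
    have "c h \<subseteq> W"
    proof
      fix u assume "u \<in> c h"
      then obtain p where p: "p \<in> P" "u = h * p * h" unfolding c_def by auto
      then have "u = e * u * e" using h by (simp add: mult.assoc) (simp flip: mult.assoc)
      moreover have "u \<in> P" using p h subalgebra_mult[OF P(1)] by blast
      ultimately show "u \<in> W" unfolding e(4) c_def by blast
    qed
    then have "c h = W" using W(2) h unfolding Q_def by blast
    moreover have "e * e * e \<in> W" using e(1) unfolding e(4) c_def by blast
    ultimately obtain p where "e = h * p * h" using e(2) unfolding c_def by auto
    then have "h * e = e" using h(2) by (simp flip: mult.assoc)
    then show ?thesis using h(4) by simp
  qed
  then have "primitive_in P e" unfolding primitive_in_def using e by blast
  then show thesis by (rule that)
qed

text \<open>A nonzero idempotent in \<open>z P\<close> would give \<open>z\<close> a right inverse r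
  in the corner of \<open>e\<close>. Primitivity makes r z equal to \<open>e\<close> as well, and
  then b = r z b = 0. The vector \<open>b\<close> may lie outside \<open>P\<close>, so that it can
  come from a different subalgebra.\<close>

lemma primitive_zero_divisor:
  assumes P: "subalgebra P" and e: "primitive_in P e"
    and z: "z \<in> P" "e * z = z" "z * e = z" and b: "e * b = b" "z * b = 0" "b \<noteq> 0"
    and p: "p \<in> P" "(z * p) * (z * p) = z * p"
  shows "z * p = 0"
proof (rule ccontr)
  assume g0: "z * p \<noteq> 0"
  have prim: "h = e" if "h \<in> P" "h * h = h" "e * h = h" "h * e = h" "h \<noteq> 0" for h
    using e that unfolding primitive_in_def by blast
  have eP: "e \<in> P" "e * e = e" using e unfolding primitive_in_def by auto
  note mP = subalgebra_mult[OF P]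
  define g where "g = z * p"
  have g: "g \<in> P" "g * g = g" "e * g = g" "g \<noteq> 0"
    using p z g0 mP unfolding g_def by (auto simp flip: mult.assoc)
  have "(g * e) * g = g" using g by (simp add: mult.assoc)
  then have "g * e \<noteq> 0" using g(4) by auto
  then have "g * e = e"
    using g eP mP by (intro prim) (auto simp: mult.assoc, auto simp flip: mult.assoc)
  define r where "r = e * (p * e)"
  have zr: "z * r = e" using \<open>g * e = e\<close> z unfolding r_def g_def by (simp flip: mult.assoc)
  have er: "e * r = r" using eP unfolding r_def by (simp flip: mult.assoc)
  have rP: "r \<in> P" using eP p mP unfolding r_def by blast
  have zrz: "z * (r * z) = z" using zr z by (simp flip: mult.assoc)
  have "r * z = e"
  proof (rule prim)
    show "r * z \<in> P" using rP z mP by blast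
    show "(r * z) * (r * z) = r * z" using zrz by (simp add: mult.assoc)
    show "e * (r * z) = r * z" using er by (simp flip: mult.assoc)
    show "(r * z) * e = r * z" using z by (simp add: mult.assoc)
    show "r * z \<noteq> 0" using zrz zr g by auto
  qed
  then have "b = r * (z * b)" using b(1) by (simp only: mult.assoc[symmetric])
  then show False using b(2,3) by simp
qed

end

context alg_closed_algebra
begin

text \<open>Left multiplication by \<open>x\<close> preserves \<open>e P\<close>, and
  \<open>e\<close> acts on that space as the identity; an eigenvector there is annihilated by x - r
  e.\<close>

lemma corner_eigenvector:
  assumes P: "subalgebra P" "fin_dim P" and e: "e \<in> P" "e * e = e" "e \<noteq> 0"
    and x: "x \<in> P" "e * x = x"
  obtains r b where "e * b = b" "b \<noteq> 0" "(x - scale r e) * b = 0"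
proof -
  let ?W = "(*) e ` P"
  have W: "subspace ?W" "?W \<subseteq> P"
    using subspace_mult_left subalgebra_subspace[OF P(1)] subalgebra_mult[OF P(1)] e(1) by auto
  have xW: "x * w \<in> ?W" if "w \<in> ?W" for w
  proof -
    have "x * w \<in> P" using W x that subalgebra_mult[OF P(1)] by blast
    moreover have "x * w = e * (x * w)" using x(2) by (simp flip: mult.assoc)
    ultimately show ?thesis by blast
  qed
  have eW: "e \<in> ?W" using e by force
  obtain r b where rb: "b \<in> ?W" "b \<noteq> 0" "x * b = scale r b"
    using eigenvector_exists[of "(*) x" ?W e] W xW eW e(3) fin_dim_subspace[OF P(2)]
    by (metis distrib_left scale_mult_right)
  have eb: "e * b = b" using rb(1) e(2) by (auto simp flip: mult.assoc)
  then have "(x - scale r e) * b = 0"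
    using rb(3) by (simp add: left_diff_distrib scale_mult_left[symmetric])
  then show thesis using that eb rb(2) by blast
qed

text \<open>Subtracting an eigenvalue produces a zero divisor z in the corner. The right ideal
  \<open>z P\<close> then has no nonzero idempotent, so it is nilpotent, and z = e z lies in
  \<open>P z P\<close>, inside the radical.\<close>

lemma primitive_corner_mod_radical:
  assumes P: "subalgebra P" "fin_dim P" and e: "primitive_in P e"
    and x: "x \<in> P" "e * x = x" "x * e = x"
  obtains r where "x - scale r e \<in> radical P"
proof -
  have eP: "e \<in> P" "e * e = e" "e \<noteq> 0" using e unfolding primitive_in_def by auto
  note mP = subalgebra_mult[OF P(1)] and sP = subalgebra_subspace[OF P(1)]
  obtain r b where b: "e * b = b" "b \<noteq> 0" "(x - scale r e) * b = 0"
    using corner_eigenvector[OF P eP x(1,2)] by blast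
  define z where "z = x - scale r e"
  have z: "z \<in> P" "e * z = z" "z * e = z"
    using x eP sP unfolding z_def
    by (auto simp: right_diff_distrib left_diff_distrib scale_mult_left[symmetric]
        scale_mult_right[symmetric] intro: subspace_diff subspace_scale)
  let ?K = "(*) z ` P"
  have K: "subspace ?K" "?K \<subseteq> P" using subspace_mult_left sP mP z(1) by auto
  have KP: "k * p \<in> ?K" if "k \<in> ?K" "p \<in> P" for k p
    using that mP by (auto simp: mult.assoc)
  have "nilpotent ?K"
  proof (rule ccontr)
    assume "\<not> nilpotent ?K"
    moreover have "subalgebra ?K" unfolding subalgebra_def using K KP by blast
    moreover have "fin_dim ?K" using fin_dim_subspace[OF P(2)] K by blast
    ultimately obtain g where "g \<in> ?K" "g * g = g" "g \<noteq> 0"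
      using nonnilpotent_idempotent by metis
    then show False
      using primitive_zero_divisor[OF P(1) e z b(1)] b unfolding z_def by blast
  qed
  then have "product_span P ?K \<subseteq> radical P"
    using nilpotent_right_ideal_radical[OF P(1) K] KP by blast
  moreover have "z \<in> ?K" using z(3) eP(1) by force
  then have "e * z \<in> product_span P ?K" using product_spanI eP(1) by blast
  ultimately have "z \<in> radical P" using z(2) by auto
  then show thesis using that unfolding z_def by blast
qed

end

section \<open>Idempotents in simple locally finite algebras\<close>

context assoc_algebra
begin

text \<open>The ideal \<open>M w M\<close>. Without an identity in \<open>M\<close> it can miss
  \<open>w\<close>, so memberships such as \<open>w \<in> sandwich M w\<close> carry
  information.\<close>

definition sandwich :: "'a set \<Rightarrow> 'a \<Rightarrow> 'a set" where
  "sandwich M w = span {a * w * b | a b. a \<in> M \<and> b \<in> M}"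

lemma subspace_sandwich [simp]: "subspace (sandwich M w)"
  unfolding sandwich_def by simp

lemma sandwichI: "a \<in> M \<Longrightarrow> b \<in> M \<Longrightarrow> a * w * b \<in> sandwich M w"
  unfolding sandwich_def by (rule span_base) blast

lemma sandwich_least:
  assumes "subspace V" "\<And>a b. a \<in> M \<Longrightarrow> b \<in> M \<Longrightarrow> a * w * b \<in> V"
  shows "sandwich M w \<subseteq> V"
  unfolding sandwich_def using assms by (intro span_minimal) auto

lemma sandwich_mult_left_least:
  assumes "subspace V" "\<And>a b. a \<in> M \<Longrightarrow> b \<in> M \<Longrightarrow> c * (a * w * b) \<in> V" "x \<in> sandwich M w"
  shows "c * x \<in> V"
  using sandwich_least[OF subspace_mult_left_preimage[OF assms(1), of c], of M w] assms by auto

lemma sandwich_mult_right_least: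
  assumes "subspace V" "\<And>a b. a \<in> M \<Longrightarrow> b \<in> M \<Longrightarrow> (a * w * b) * c \<in> V" "x \<in> sandwich M w"
  shows "x * c \<in> V"
  using sandwich_least[OF subspace_mult_right_preimage[OF assms(1), of c], of M w] assms by auto

lemma sandwich_ideal:
  assumes M: "subalgebra M" and w: "w \<in> M"
  shows "alg_ideal (alg_on M) (sandwich M w)"
  unfolding alg_ideal_alg_on_iff
proof (intro conjI ballI)
  show "sandwich M w \<subseteq> M"
    by (rule sandwich_least) (use M w in \<open>auto intro: subalgebra_mult subalgebra_subspace\<close>)
  fix c x assume c: "c \<in> M" and x: "x \<in> sandwich M w"
  show "c * x \<in> sandwich M w"
  proof (rule sandwich_mult_left_least[OF _ _ x])
    fix a b assume "a \<in> M" "b \<in> M"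
    then show "c * (a * w * b) \<in> sandwich M w"
      using sandwichI[of "c * a" M b w] subalgebra_mult[OF M c] by (simp add: mult.assoc)
  qed simp
  show "x * c \<in> sandwich M w"
  proof (rule sandwich_mult_right_least[OF _ _ x])
    fix a b assume "a \<in> M" "b \<in> M"
    then show "a * w * b * c \<in> sandwich M w"
      using sandwichI[of a M "b * c" w] subalgebra_mult[OF M _ c] by (simp add: mult.assoc)
  qed simp
qed simp

lemma sandwich_trans:
  assumes "subalgebra M" "v \<in> M" "w \<in> sandwich M v"
  shows "sandwich M w \<subseteq> sandwich M v"
  using sandwich_ideal[OF assms(1,2)] assms(3) unfolding alg_ideal_alg_on_iff
  by (intro sandwich_least) auto

text \<open>A membership involves finitely many factors and persists in every \<open>M\<close>
  containing them. Combined with local finiteness this carries facts from the whole algebra down to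
  a finite dimensional subalgebra.\<close>

lemma sandwich_finite_support:
  assumes "x \<in> sandwich UNIV w"
  obtains T where "finite T" "\<And>M. T \<subseteq> M \<Longrightarrow> x \<in> sandwich M w"
proof -
  let ?V = "{x. \<exists>T. finite T \<and> (\<forall>M. T \<subseteq> M \<longrightarrow> x \<in> sandwich M w)}"
  have "subspace ?V"
  proof (rule subspaceI)
    show "0 \<in> ?V" using subspace_0[OF subspace_sandwich] by blast
  next
    fix x y assume "x \<in> ?V" "y \<in> ?V"
    then obtain T U where "finite T" "\<forall>M. T \<subseteq> M \<longrightarrow> x \<in> sandwich M w"
      "finite U" "\<forall>M. U \<subseteq> M \<longrightarrow> y \<in> sandwich M w" by blast
    then show "x + y \<in> ?V"
      by (auto intro!: exI[of _ "T \<union> U"] subspace_add)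
  next
    fix c x assume "x \<in> ?V"
    then obtain T where "finite T" "\<forall>M. T \<subseteq> M \<longrightarrow> x \<in> sandwich M w" by blast
    then show "scale c x \<in> ?V" by (auto intro!: exI[of _ T] subspace_scale)
  qed
  moreover have "a * w * b \<in> ?V" for a b
    by (auto intro!: exI[of _ "{a, b}"] sandwichI)
  ultimately have "sandwich UNIV w \<subseteq> ?V" by (rule sandwich_least)
  then show thesis using assms that by blast
qed

lemma subspace_power_mult_right:
  assumes "\<And>k m. k \<in> K \<Longrightarrow> m \<in> M \<Longrightarrow> k * m \<in> K" "x \<in> subspace_power K n" "m \<in> M"
  shows "x * m \<in> subspace_power K n"
  using assms(2)
proof (induction n arbitrary: x)
  case 0
  then show ?case using assms(1,3) by simp
next
  case (Suc n)
  show ?case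
  proof (rule product_span_mult_right[of _ K "subspace_power K n"])
    show "x \<in> product_span K (subspace_power K n)" using Suc.prems by simp
    show "y * z * m \<in> subspace_power K (Suc n)" if "y \<in> K" "z \<in> subspace_power K n" for y z
      using product_spanI[OF that(1) Suc.IH[OF that(2)]] by (simp add: mult.assoc)
  qed simp
qed

definition orth_idempotents :: "'a set \<Rightarrow> bool" where
  "orth_idempotents E \<longleftrightarrow>
     (\<forall>e\<in>E. e * e = e \<and> e \<noteq> 0) \<and> (\<forall>e\<in>E. \<forall>f\<in>E. e \<noteq> f \<longrightarrow> e * f = 0)"

lemma orth_idempotents_insert:
  assumes "orth_idempotents E" "g * g = g" "g \<noteq> 0" "\<And>e. e \<in> E \<Longrightarrow> g * e = 0 \<and> e * g = 0"
  shows "orth_idempotents (insert g E)" "g \<notin> E"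
  using assms unfolding orth_idempotents_def by auto

end

section \<open>Primeness, a first idempotent, and exact corners in a simple algebra\<close>

locale simple_locally_finite_algebra = alg_closed_algebra scale
  for scale :: "'f :: alg_closed_field \<Rightarrow> 'a :: ring \<Rightarrow> 'a" +
  assumes simple: "simple_alg (alg_on UNIV)"
    and locally_finite: "locally_finite"
begin

lemma ideal_trivial:
  assumes "subspace I" "\<And>a x. x \<in> I \<Longrightarrow> a * x \<in> I" "\<And>a x. x \<in> I \<Longrightarrow> x * a \<in> I" "x \<in> I" "x \<noteq> 0"
  shows "I = UNIV"
proof -
  have "alg_ideal (alg_on UNIV) I" unfolding alg_ideal_alg_on_iff using assms by auto
  then have "I = {0} \<or> I = UNIV" using simple unfolding simple_alg_def by (simp add: alg_on_def)
  then show ?thesis using assms(4,5) by auto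
qed

lemma product_nonzero: obtains u v :: 'a where "u * v \<noteq> 0"
  using simple unfolding simple_alg_def by (simp add: alg_on_def) blast

text \<open>The x with a x b = 0 for all a, b form an ideal. If \<open>w\<close> were in it, all
  products of three elements would vanish. But the span of all products of two is a nonzero ideal,
  so the whole algebra, and all products of two would vanish too.\<close>

lemma sandwich_UNIV:
  assumes "w \<noteq> 0"
  shows "sandwich UNIV w = UNIV"
proof -
  have M: "subalgebra UNIV" unfolding subalgebra_def by simp
  have "\<exists>a b. a * w * b \<noteq> 0"
  proof (rule ccontr)
    assume neg: "\<not> ?thesis"
    have "{x :: 'a. \<forall>a b. a * x * b = 0} = UNIV"
    proof (rule ideal_trivial)
      show "subspace {x :: 'a. \<forall>a b. a * x * b = 0}"
        by (rule subspaceI)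
          (auto simp: distrib_left distrib_right scale_mult_left[symmetric] scale_mult_right[symmetric])
      show "a * x \<in> {x. \<forall>a b. a * x * b = 0}" if "x \<in> {x. \<forall>a b. a * x * b = 0}" for a x :: 'a
      proof -
        have "c * (a * x) * d = (c * a) * x * d" for c d by (simp only: mult.assoc)
        then show ?thesis using that by simp
      qed
      show "x * a \<in> {x. \<forall>a b. a * x * b = 0}" if "x \<in> {x. \<forall>a b. a * x * b = 0}" for a x :: 'a
      proof -
        have "c * (x * a) * d = c * x * (a * d)" for c d by (simp only: mult.assoc)
        then show ?thesis using that by simp
      qed
    qed (use assms neg in auto)
    then have 0: "a * x * b = 0" for a x b :: 'a by blast
    obtain u v :: 'a where uv: "u * v \<noteq> 0" by (rule product_nonzero)
    have U: "product_span UNIV UNIV = UNIV"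
      by (rule ideal_trivial[OF _ _ _ product_spanI uv]) (auto intro: product_spanI)
    have "u * v \<in> {0}"
      by (rule product_span_mult_right[of "{0}" UNIV UNIV]) (simp_all add: 0 U)
    then show False using uv by simp
  qed
  then obtain a b where "a * w * b \<noteq> 0" by blast
  then show ?thesis
    using sandwich_ideal[OF M, of w] unfolding alg_ideal_alg_on_iff
    by (intro ideal_trivial[of _ "a * w * b"]) (auto intro: sandwichI)
qed

text \<open>Both \<open>u\<close> and \<open>v\<close> generate the whole algebra A in the form A u
  A and A v A, so u A v = 0 would make every product vanish.\<close>

lemma prime_algebra:
  fixes u v :: 'a
  assumes "u \<noteq> 0" "v \<noteq> 0"
  obtains r where "u * r * v \<noteq> 0"
proof (rule ccontr)
  assume "\<not> thesis"
  then have 0: "u * r * v = 0" for r using that by blast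
  have *: "(a * u * b) * y = 0" for a b y
  proof -
    have "(a * u * b) * y \<in> {0}"
    proof (rule sandwich_mult_left_least)
      show "y \<in> sandwich UNIV v" using sandwich_UNIV[OF assms(2)] by simp
      fix c d :: 'a
      have "(a * u * b) * (c * v * d) = a * (u * (b * c) * v) * d" by (simp only: mult.assoc)
      then show "(a * u * b) * (c * v * d) \<in> {0}" using 0 by simp
    qed simp
    then show ?thesis by simp
  qed
  have "x * y \<in> {0}" for x y :: 'a
  proof (rule sandwich_mult_right_least)
    show "x \<in> sandwich UNIV u" using sandwich_UNIV[OF assms(1)] by simp
  qed (use * in auto)
  then show False using product_nonzero by blast
qed

lemma finite_sandwich:
  assumes "finite S" "finite W" "0 \<notin> W"
  obtains M where "subalgebra M" "fin_dim M" "S \<union> W \<subseteq> M"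
    "\<And>x w. x \<in> S \<Longrightarrow> w \<in> W \<Longrightarrow> x \<in> sandwich M w"
proof -
  have "\<forall>x w. \<exists>T. w \<in> W \<longrightarrow> finite T \<and> (\<forall>M. T \<subseteq> M \<longrightarrow> x \<in> sandwich M w)"
    using sandwich_UNIV sandwich_finite_support assms(3) by (metis UNIV_I)
  then obtain T where T: "\<And>x w. w \<in> W \<Longrightarrow> finite (T x w)"
    "\<And>x w M. w \<in> W \<Longrightarrow> T x w \<subseteq> M \<Longrightarrow> x \<in> sandwich M w"
    by metis
  have "finite (S \<union> W \<union> (\<Union>x\<in>S. \<Union>w\<in>W. T x w))" using assms T(1) by auto
  then obtain M where "subalgebra M" "fin_dim M" "S \<union> W \<union> (\<Union>x\<in>S. \<Union>w\<in>W. T x w) \<subseteq> M"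
    using locally_finite unfolding locally_finite_def by meson
  moreover from this have "x \<in> sandwich M w" if "x \<in> S" "w \<in> W" for x w
    using T(2)[OF that(2)] that by blast
  ultimately show thesis using that[of M] by blast
qed

lemma sandwich_witness:
  assumes "w \<noteq> 0"
  obtains M where "subalgebra M" "fin_dim M" "x \<in> M" "w \<in> M" "x \<in> sandwich M w"
  by (rule finite_sandwich[of "{x}" "{w}"]) (use assms that in auto)

text \<open>For nonzero w in \<open>M w M\<close>, membership of w in one power of \<open>M\<close>
  gives membership in the next. So \<open>M\<close> is not nilpotent.\<close>

lemma idempotent_exists: obtains g :: 'a where "g * g = g" "g \<noteq> 0"
proof -
  obtain w :: 'a where w: "w \<noteq> 0" using product_nonzero by (metis mult_zero_left)
  obtain M where M: "subalgebra M" "fin_dim M" "w \<in> M" "w \<in> sandwich M w"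
    using sandwich_witness[OF w] by metis
  have "w \<in> subspace_power M n" for n
  proof (induction n)
    case (Suc n)
    have "sandwich M w \<subseteq> subspace_power M (Suc n)"
    proof (rule sandwich_least)
      fix a b assume "a \<in> M" "b \<in> M"
      moreover from this have "w * b \<in> subspace_power M n"
        using subspace_power_mult_right[OF subalgebra_mult[OF M(1)] Suc] by blast
      ultimately show "a * w * b \<in> subspace_power M (Suc n)"
        using product_spanI[of a M "w * b" "subspace_power M n"] by (simp add: mult.assoc)
    qed simp
    then show ?case using M(4) by blast
  qed (use M in simp)
  then have "\<not> nilpotent M" using w unfolding nilpotent_def by (metis singletonD)
  then show thesis using nonnilpotent_idempotent[OF M(1,2)] that by metis
qed

text \<open>As in \<open>primitive_corner_mod_radical\<close>, the element z = x - r e makes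
  \<open>z M\<close> nilpotent. Simplicity now removes the error term: if z is nonzero, a suitable
  \<open>M\<close> has e in \<open>M z M\<close>, whence z = z e lies in every power of
  \<open>z M\<close>.\<close>

lemma primitive_corner:
  assumes e: "primitive_in UNIV e" and x: "e * x = x" "x * e = x"
  obtains r where "x = scale r e"
proof -
  have ee: "e * e = e" "e \<noteq> 0" using e unfolding primitive_in_def by auto
  have prim: "primitive_in M e" if "e \<in> M" for M using e that unfolding primitive_in_def by blast
  obtain B where B: "subalgebra B" "fin_dim B" "{x, e} \<subseteq> B"
    using locally_finite unfolding locally_finite_def by (metis finite.emptyI finite.insertI)
  then obtain r b where b: "e * b = b" "b \<noteq> 0" "(x - scale r e) * b = 0"
    using corner_eigenvector[OF B(1,2) _ ee _ x(1)] by blast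
  define z where "z = x - scale r e"
  have z: "e * z = z" "z * e = z"
    using x ee unfolding z_def
    by (auto simp: right_diff_distrib left_diff_distrib scale_mult_left[symmetric]
        scale_mult_right[symmetric])
  have "z = 0"
  proof (rule ccontr)
    assume "z \<noteq> 0"
    \<comment> \<open>\<open>M\<close> depends on \<open>z\<close> and need not contain the
      eigenvector \<open>b\<close>, which was found in \<open>B\<close>.\<close>
    then obtain M where M: "subalgebra M" "fin_dim M" "e \<in> M" "z \<in> M" "e \<in> sandwich M z"
      using sandwich_witness by metis
    let ?K = "(*) z ` M"
    note mM = subalgebra_mult[OF M(1)]
    have K: "subspace ?K" "?K \<subseteq> M"
      using subspace_mult_left subalgebra_subspace[OF M(1)] mM M(4) by auto
    have KM: "k * p \<in> ?K" if "k \<in> ?K" "p \<in> M" for k p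
      using that mM by (auto simp: mult.assoc)
    have "nilpotent ?K"
    proof (rule ccontr)
      assume "\<not> nilpotent ?K"
      moreover have "subalgebra ?K" unfolding subalgebra_def using K KM by blast
      moreover have "fin_dim ?K" using fin_dim_subspace[OF M(2)] K by blast
      ultimately obtain g where "g \<in> ?K" "g * g = g" "g \<noteq> 0"
        using nonnilpotent_idempotent by metis
      then show False
        using primitive_zero_divisor[OF M(1) prim[OF M(3)] M(4) z b(1)] b unfolding z_def by blast
    qed
    moreover have "z \<in> subspace_power ?K n" for n
    proof (induction n)
      case 0
      have "z * e \<in> ?K" using M(3) by blast
      then show ?case using z(2) by simp
    next
      case (Suc n)
      have "z * e \<in> subspace_power ?K (Suc n)"
      \<comment> \<open>Expanding e in \<open>M z M\<close> turns z e into a sum of products (z a)(z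
        b), with z a in \<open>z M\<close> and z b in the power reached so far.\<close>
      proof (rule sandwich_mult_left_least[OF _ _ M(5)])
        fix a b assume ab: "a \<in> M" "b \<in> M"
        have "z * b \<in> subspace_power ?K n"
          using subspace_power_mult_right[OF KM Suc ab(2)] .
        then show "z * (a * z * b) \<in> subspace_power ?K (Suc n)"
          using product_spanI[of "z * a" ?K "z * b"] ab(1) by (simp add: mult.assoc)
      qed (use K in simp)
      then show ?case using z(2) by simp
    qed
    ultimately show False using \<open>z \<noteq> 0\<close> unfolding nilpotent_def by (metis singletonD)
  qed
  then have "x = scale r e" unfolding z_def by simp
  then show thesis by (rule that)
qed

text \<open>Primeness provides c with e c x nonzero. This element lies in the corner of
  \<open>e\<close>, so it is a nonzero multiple of \<open>e\<close>, and rescaling e c gives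
  \<open>y\<close>.\<close>

lemma primitive_corner_inverse:
  assumes e: "primitive_in UNIV e" and x: "x \<noteq> 0" "x * e = x"
  obtains y where "y * x = e" "e * y = y"
proof -
  have ee: "e * e = e" "e \<noteq> 0" using e unfolding primitive_in_def by auto
  obtain c where c: "e * c * x \<noteq> 0" using prime_algebra[OF ee(2) x(1)] by blast
  obtain r where r: "e * c * x = scale r e"
    using primitive_corner[OF e, of "e * c * x"] ee(1) x(2) by (auto simp: mult.assoc) (metis mult.assoc)
  have "r \<noteq> 0" using c r by auto
  show thesis
  proof (rule that)
    show "scale (inverse r) (e * c) * x = e"
      using r \<open>r \<noteq> 0\<close> by (simp add: scale_mult_left[symmetric])
    show "e * scale (inverse r) (e * c) = scale (inverse r) (e * c)"
      using ee(1) by (simp add: scale_mult_right[symmetric] mult.assoc[symmetric])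
  qed
qed

lemma primitive_corner_inverse':
  assumes e: "primitive_in UNIV e" and x: "x \<noteq> 0" "e * x = x"
  obtains y where "x * y = e" "y * e = y"
proof -
  have ee: "e * e = e" "e \<noteq> 0" using e unfolding primitive_in_def by auto
  obtain c where c: "x * c * e \<noteq> 0" using prime_algebra[OF x(1) ee(2)] by blast
  have "e * (x * c * e) = x * c * e" using x(2) by (simp flip: mult.assoc)
  moreover have "x * c * e * e = x * c * e" using ee(1) by (simp add: mult.assoc)
  ultimately obtain r where r: "x * c * e = scale r e"
    using primitive_corner[OF e] by blast
  have "r \<noteq> 0" using c r by auto
  show thesis
  proof (rule that)
    show "x * scale (inverse r) (c * e) = e"
      using r \<open>r \<noteq> 0\<close> by (simp add: scale_mult_right[symmetric] mult.assoc[symmetric])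
    show "scale (inverse r) (c * e) * e = scale (inverse r) (c * e)"
      using ee(1) by (simp add: scale_mult_left[symmetric] mult.assoc)
  qed
qed

text \<open>With \<open>f\<close> in \<open>M e M\<close>, every x = f x f lies in M e (M x M) e M.
  The inner corner factor is a scalar multiple of e, so x already lies in the finite dimensional
  \<open>M e M\<close>.\<close>

lemma primitive_fin_dim:
  fixes f :: 'a
  assumes e: "primitive_in UNIV e" and f: "\<And>x. f * x = x" "\<And>x. x * f = x"
  shows "fin_dim UNIV"
proof -
  have ee: "e * e = e" "e \<noteq> 0" using e unfolding primitive_in_def by auto
  obtain M where M: "subalgebra M" "fin_dim M" "e \<in> M" "f \<in> M" "f \<in> sandwich M e"
    using sandwich_witness[OF ee(2)] by metis
  have *: "a * e * b * x * f \<in> sandwich M e" if "a \<in> M" "b \<in> M" for a b x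
  proof (rule sandwich_mult_left_least[OF _ _ M(5)])
    fix c d assume cd: "c \<in> M" "d \<in> M"
    let ?y = "e * (b * x * c) * e"
    have "e * ?y = ?y" using ee(1) by (simp flip: mult.assoc)
    moreover have "?y * e = ?y" using ee(1) by (simp add: mult.assoc)
    ultimately obtain r where r: "?y = scale r e" using primitive_corner[OF e] by blast
    have "a * e * b * x * (c * e * d) = a * ?y * d" by (simp only: mult.assoc)
    also have "\<dots> = scale r (a * e * d)"
      unfolding r by (simp add: scale_mult_left[symmetric] scale_mult_right[symmetric])
    finally show "a * e * b * x * (c * e * d) \<in> sandwich M e"
      using subspace_scale[OF subspace_sandwich sandwichI[of a M d e]] that cd by simp
  qed simp
  have "f * (x * f) \<in> sandwich M e" for x
  proof (rule sandwich_mult_right_least[OF _ _ M(5)])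
    show "a * e * b * (x * f) \<in> sandwich M e" if "a \<in> M" "b \<in> M" for a b
      using *[OF that, of x] by (simp add: mult.assoc)
  qed simp
  then have "UNIV \<subseteq> sandwich M e" using f by (metis subsetI)
  moreover have "sandwich M e \<subseteq> M" using sandwich_ideal[OF M(1,3)] unfolding alg_ideal_alg_on_iff by blast
  ultimately show ?thesis using M(2) by (metis top.extremum_uniqueI order_trans)
qed

section \<open>Enlarging an orthogonal family and placing it in a perfect subalgebra\<close>

lemma orth_idempotents_extend:
  assumes E: "finite E" "orth_idempotents E" "E \<noteq> {}" and inf: "\<not> fin_dim UNIV"
  obtains E' where "finite E'" "orth_idempotents E'" "card E' = Suc (card E)"
proof -
  obtain e where e: "e \<in> E" using E(3) by blast
  have E_idem: "\<And>e. e \<in> E \<Longrightarrow> e * e = e" "\<And>e. e \<in> E \<Longrightarrow> e \<noteq> 0"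
    and E_orth: "\<And>e f. e \<in> E \<Longrightarrow> f \<in> E \<Longrightarrow> e \<noteq> f \<Longrightarrow> e * f = 0"
    using E(2) unfolding orth_idempotents_def by auto
  note ee = E_idem[OF e]
  show thesis
  proof (cases "primitive_in UNIV e")
    case False
    then obtain h where h: "h * h = h" "e * h = h" "h * e = h" "h \<noteq> 0" "h \<noteq> e"
      using ee unfolding primitive_in_def by auto
    \<comment> \<open>Replacing e by the two idempotents \<open>h\<close> and \<open>e - h\<close>
      keeps orthogonality and raises the count by one.\<close>
    let ?E = "E - {e}"
    have E1: "orth_idempotents ?E" using E(2) unfolding orth_idempotents_def by blast
    have hf: "h * f = 0" "f * h = 0" if "f \<in> ?E" for f
    proof -
      have "h * f = h * (e * f)" using h(3) by (simp flip: mult.assoc)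
      then show "h * f = 0" using E_orth e that by auto
      have "f * h = (f * e) * h" using h(2) by (simp add: mult.assoc)
      then show "f * h = 0" using E_orth e that by auto
    qed
    have "k * f = 0 \<and> f * k = 0" if "f \<in> ?E" "k = e - h" for f k
      using hf[OF that(1)] E_orth[OF e] E_orth[OF _ e] that
      by (auto simp: left_diff_distrib right_diff_distrib)
    moreover have "(e - h) * (e - h) = e - h"
      using h ee by (simp add: left_diff_distrib right_diff_distrib)
    ultimately have E2: "orth_idempotents (insert (e - h) ?E)" "e - h \<notin> ?E"
      using orth_idempotents_insert[OF E1, of "e - h"] h(5) by auto
    have "h * f = 0 \<and> f * h = 0" if "f \<in> insert (e - h) ?E" for f
      using that hf h by (auto simp: left_diff_distrib right_diff_distrib)
    then have E3: "orth_idempotents (insert h (insert (e - h) ?E))" "h \<notin> insert (e - h) ?E"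
      using orth_idempotents_insert[OF E2(1) h(1,4)] by auto
    have "card (insert h (insert (e - h) ?E)) = Suc (Suc (card ?E))"
      using E(1) E2(2) E3(2) by simp
    also have "Suc (card ?E) = card E" using card_Suc_Diff1[OF E(1) e] .
    finally show thesis using that[OF _ E3(1)] E(1) by blast
  next
    case True
    define f where "f = \<Sum>E"
    have fE: "f * k = k" "k * f = k" if "k \<in> E" for k
    proof -
      have "f * k = (\<Sum>k'\<in>E. if k' = k then k else 0)"
        unfolding f_def sum_distrib_right by (rule sum.cong) (use that E_idem E_orth in auto)
      then show "f * k = k" using that E(1) by simp
      have "k * f = (\<Sum>k'\<in>E. if k' = k then k else 0)"
        unfolding f_def sum_distrib_left by (rule sum.cong) (use that E_idem E_orth in auto)
      then show "k * f = k" using that E(1) by simp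
    qed
    have ff: "f * f = f"
    proof -
      have "f * f = (\<Sum>k\<in>E. f * k)" by (subst (2) f_def) (rule sum_distrib_left)
      also have "\<dots> = f" unfolding f_def using fE(1)[unfolded f_def] by (rule sum.cong[OF refl])
      finally show ?thesis .
    qed
    have "\<exists>g. g * g = g \<and> g \<noteq> 0 \<and> f * g = 0 \<and> g * f = 0"
    proof (cases "\<exists>a. f * a \<noteq> a")
      case True
      \<comment> \<open>This is (1 - f) a in a formal unital notation. Primeness moves it to a
        nonzero x in (1 - f) A e, and the idempotent sought is x y' for a left inverse y' of x that
        f annihilates from the right.\<close>
      then obtain a where a: "a - f * a \<noteq> 0" by (metis right_minus_eq)
      obtain b where "(a - f * a) * b * e \<noteq> 0" using prime_algebra[OF a ee(2)] by blast
      then obtain x where x: "x \<noteq> 0" "x * e = x" "f * x = 0"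
        using ff ee(1) by (metis (no_types, lifting) diff_self mult.assoc mult_zero_left right_diff_distrib)
      obtain y where y: "y * x = e" "e * y = y"
        using primitive_corner_inverse[OF \<open>primitive_in UNIV e\<close> x(1,2)] by blast
      \<comment> \<open>Subtracting \<open>y * f\<close> gives y' f = 0, and y' x is still e because
        f x = 0.\<close>
      define y' where "y' = y - y * f"
      have y': "y' * x = e" "e * y' = y'" "y' * f = 0"
        using y x(3) ff unfolding y'_def
        by (auto simp: left_diff_distrib right_diff_distrib mult.assoc) (auto simp flip: mult.assoc)
      have "(x * y') * (x * y') = x * ((y' * x) * y')" by (simp only: mult.assoc)
      then have "(x * y') * (x * y') = x * y'" using y' by simp
      moreover have "x * y' \<noteq> 0"
      proof
        assume "x * y' = 0"
        then have "y' * (x * y') * x = 0" by simp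
        moreover have "y' * (x * y') * x = (y' * x) * (y' * x)" by (simp only: mult.assoc)
        ultimately show False using y'(1) ee by simp
      qed
      moreover have "f * (x * y') = 0" using x(3) by (simp flip: mult.assoc)
      moreover have "x * y' * f = 0" using y'(3) by (simp add: mult.assoc)
      ultimately show ?thesis by blast
    next
      case False
      \<comment> \<open>Here \<open>f\<close> is a left identity; if it were also a right one, the
        algebra would be finite dimensional. The rest mirrors the previous case, with x in e A (1 -
        f).\<close>
      then obtain a where a: "a - a * f \<noteq> 0"
        using primitive_fin_dim[OF \<open>primitive_in UNIV e\<close>, of f] inf by (metis right_minus_eq)
      obtain b where "e * b * (a - a * f) \<noteq> 0" using prime_algebra[OF ee(2) a] by blast
      moreover have "e * (e * b * (a - a * f)) = e * b * (a - a * f)"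
        using ee(1) by (simp flip: mult.assoc)
      moreover have "e * b * (a - a * f) * f = 0"
        using ff by (simp add: mult.assoc left_diff_distrib)
      ultimately obtain x where x: "x \<noteq> 0" "e * x = x" "x * f = 0" by blast
      obtain y where y: "x * y = e" "y * e = y"
        using primitive_corner_inverse'[OF \<open>primitive_in UNIV e\<close> x(1,2)] by blast
      define y' where "y' = y - f * y"
      have "x * (f * y) = 0" using x(3) by (simp flip: mult.assoc)
      then have xy': "x * y' = e" using y(1) unfolding y'_def by (simp add: right_diff_distrib)
      have y'e: "y' * e = y'" using y(2) unfolding y'_def by (simp add: left_diff_distrib mult.assoc)
      have fy': "f * y' = 0"
        using ff unfolding y'_def by (simp add: right_diff_distrib flip: mult.assoc)
      have "(y' * x) * (y' * x) = y' * (x * y') * x" by (simp only: mult.assoc)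
      then have "(y' * x) * (y' * x) = y' * x" using xy' y'e by simp
      moreover have "y' * x \<noteq> 0"
      proof
        assume "y' * x = 0"
        then have "x * (y' * x) * y' = 0" by simp
        moreover have "x * (y' * x) * y' = (x * y') * (x * y')" by (simp only: mult.assoc)
        ultimately show False using xy' ee by simp
      qed
      moreover have "f * (y' * x) = 0" using fy' by (simp flip: mult.assoc)
      moreover have "y' * x * f = 0" using x(3) by (simp add: mult.assoc)
      ultimately show ?thesis by blast
    qed
    then obtain g where g: "g * g = g" "g \<noteq> 0" "f * g = 0" "g * f = 0" by blast
    have "g * k = 0 \<and> k * g = 0" if "k \<in> E" for k
    proof -
      have "g * k = (g * f) * k" using fE(1)[OF that] by (simp add: mult.assoc)
      moreover have "k * g = k * (f * g)" using fE(2)[OF that] by (simp flip: mult.assoc)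
      ultimately show ?thesis using g by simp
    qed
    then show thesis
      using orth_idempotents_insert[OF E(2) g(1,2)] that[of "insert g E"] E(1) by simp
  qed
qed

lemma orth_idempotents_exist:
  assumes "\<not> fin_dim UNIV"
  shows "\<exists>E. finite E \<and> orth_idempotents E \<and> card E = Suc n"
proof (induction n)
  case 0
  obtain g :: 'a where g: "g * g = g" "g \<noteq> 0" by (rule idempotent_exists)
  then show ?case by (intro exI[of _ "{g}"]) (auto simp: orth_idempotents_def)
next
  case (Suc n)
  then show ?case using orth_idempotents_extend assms by (metis card.empty nat.distinct(1))
qed

text \<open>The point is to have factors from \<open>P\<close> rather than from \<open>M\<close>.
  Writing e = eee shows a e b = (a e) e (e b) with outer factors in \<open>P\<close>; multiplying e
  in \<open>M w M\<close> by e on both sides gives e in \<open>P w P\<close> for each w in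
  \<open>E\<close>.\<close>

lemma full_idempotents_subalgebra:
  assumes S: "finite S" and E: "finite E" "orth_idempotents E" "e \<in> E"
  obtains P where "subalgebra P" "fin_dim P" "perfect P" "S \<subseteq> P" "E \<subseteq> P"
    "\<And>w. w \<in> E \<Longrightarrow> P \<subseteq> sandwich P w"
proof -
  have idem: "k * k = k" "k \<noteq> 0" if "k \<in> E" for k
    using E(2) that unfolding orth_idempotents_def by auto
  obtain M where M: "subalgebra M" "fin_dim M" "S \<union> E \<subseteq> M"
    and MS: "\<And>x w. x \<in> S \<union> E \<Longrightarrow> w \<in> E \<Longrightarrow> x \<in> sandwich M w"
    using finite_sandwich[of "S \<union> E" E] S E idem by auto
  define P where "P = sandwich M e"
  have eM: "e \<in> M" using M(3) E(3) by blast
  have ideal: "alg_ideal (alg_on M) P" unfolding P_def by (rule sandwich_ideal[OF M(1) eM])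
  note PM = ideal[unfolded alg_ideal_alg_on_iff]
  have sub: "subalgebra P" by (rule alg_ideal_subalgebra[OF ideal])
  have SE: "S \<union> E \<subseteq> P" using MS E(3) unfolding P_def by blast
  have eP: "e \<in> P" using SE E(3) by blast
  have "P \<subseteq> sandwich P e"
  proof -
    have "sandwich M e \<subseteq> sandwich P e"
    proof (rule sandwich_least)
      fix a b assume ab: "a \<in> M" "b \<in> M"
      then have "(a * e) * e * (e * b) \<in> sandwich P e" using PM eP by (intro sandwichI) auto
      moreover have "(a * e) * e * (e * b) = a * (e * e * e) * b" by (simp only: mult.assoc)
      ultimately show "a * e * b \<in> sandwich P e" using idem(1)[OF E(3)] by simp
    qed simp
    then show ?thesis unfolding P_def .
  qed
  moreover have "e \<in> sandwich P w" if w: "w \<in> E" for w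
  proof -
    \<comment> \<open>The right multiplication by e is hidden in a preimage, so that the rule for
      left multiplication of a sandwich applies.\<close>
    have "e * e \<in> {x. x * e \<in> sandwich P w}"
    proof (rule sandwich_mult_left_least)
      show "e \<in> sandwich M w" using MS E(3) w by blast
      show "subspace {x. x * e \<in> sandwich P w}" by (rule subspace_mult_right_preimage) simp
      fix a b assume "a \<in> M" "b \<in> M"
      then have "(e * a) * w * (b * e) \<in> sandwich P w" using PM eP by (intro sandwichI) auto
      then show "e * (a * w * b) \<in> {x. x * e \<in> sandwich P w}" by (simp add: mult.assoc)
    qed
    then show ?thesis using idem(1)[OF E(3)] by simp
  qed
  ultimately have full: "P \<subseteq> sandwich P w" if "w \<in> E" for w
    using sandwich_trans[OF sub, of w e] SE that by blast
  have "perfect P"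
    unfolding perfect_def
  proof
    show "product_span P P \<subseteq> P"
      using sub by (intro product_span_least) (auto intro: subalgebra_subspace subalgebra_mult)
    have "sandwich P e \<subseteq> product_span P P"
      using eP by (intro sandwich_least) (auto intro!: product_spanI subalgebra_mult[OF sub])
    then show "P \<subseteq> product_span P P" using full E(3) by blast
  qed
  moreover have "fin_dim P" using fin_dim_subspace[OF M(2)] PM by blast
  ultimately show thesis using that sub SE full by blast
qed

end

section \<open>Quotients and the ranks of their components\<close>

text \<open>Choose a nonzero entry of each \<open>T k\<close>. The rescaled row of
  \<open>T k\<close> through it, times the column of \<open>T m\<close> through its chosen entry, is
  an entry of T k T m and hence a Kronecker delta. This factors the identity of size N through
  dimension n.\<close>

lemma orth_idempotent_matrices_card:
  fixes T :: "nat \<Rightarrow> 'f :: field mat"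
  assumes T: "\<And>k. k < N \<Longrightarrow> T k \<in> carrier_mat n n" "\<And>k. k < N \<Longrightarrow> T k \<noteq> 0\<^sub>m n n"
    and idem: "\<And>k. k < N \<Longrightarrow> T k * T k = T k"
    and orth: "\<And>k m. k < N \<Longrightarrow> m < N \<Longrightarrow> k \<noteq> m \<Longrightarrow> T k * T m = 0\<^sub>m n n"
  shows "N \<le> n"
proof (rule ccontr)
  assume "\<not> N \<le> n"
  then have nN: "n < N" by simp
  have "\<exists>i j. i < n \<and> j < n \<and> T k $$ (i, j) \<noteq> 0" if "k < N" for k
  proof (rule ccontr)
    assume "\<not> ?thesis"
    then have "T k = 0\<^sub>m n n" using T(1)[OF that] by (intro eq_matI) auto
    then show False using T(2)[OF that] by simp
  qed
  then obtain r c where rc: "\<And>k. k < N \<Longrightarrow> r k < n \<and> c k < n \<and> T k $$ (r k, c k) \<noteq> 0"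
    by metis
  \<comment> \<open>Both factors are padded with zeros to size N, so that a one-sided inverse of a
    square matrix is two-sided.\<close>
  define L where "L = mat N N (\<lambda>(k, i). if i < n then T k $$ (r k, i) / T k $$ (r k, c k) else 0)"
  define V where "V = mat N N (\<lambda>(i, k). if i < n then T k $$ (i, c k) else 0)"
  have LV: "L \<in> carrier_mat N N" "V \<in> carrier_mat N N" unfolding L_def V_def by auto
  have "L * V = 1\<^sub>m N"
  proof (rule eq_matI)
    fix k m assume "k < dim_row (1\<^sub>m N :: 'f mat)" "m < dim_col (1\<^sub>m N :: 'f mat)"
    then have km: "k < N" "m < N" by auto
    have "(L * V) $$ (k, m) =
      (\<Sum>i<N. if i < n then T k $$ (r k, i) / T k $$ (r k, c k) * T m $$ (i, c m) else 0)"
      using km unfolding L_def V_def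
      by (auto simp: scalar_prod_def atLeast0LessThan intro!: sum.cong)
    also have "\<dots> = (\<Sum>i<n. T k $$ (r k, i) / T k $$ (r k, c k) * T m $$ (i, c m))"
      using nN by (intro sum.mono_neutral_cong_right) auto
    also have "\<dots> = (T k * T m) $$ (r k, c m) / T k $$ (r k, c k)"
      using T(1)[OF km(1)] T(1)[OF km(2)] rc[OF km(1)] rc[OF km(2)]
      by (auto simp: scalar_prod_def atLeast0LessThan sum_divide_distrib intro!: sum.cong)
    also have "\<dots> = 1\<^sub>m N $$ (k, m)"
      using km idem orth[OF km] rc by (cases "k = m") auto
    finally show "(L * V) $$ (k, m) = 1\<^sub>m N $$ (k, m)" .
  qed (use LV in auto)
  then have "V * L = 1\<^sub>m N" using mat_mult_left_right_inverse[OF LV] by blast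
  \<comment> \<open>Indices start at 0, so row n is the first padded row of
    \<open>V\<close>.\<close>
  moreover have "(V * L) $$ (n, n) = 0"
    using nN unfolding V_def L_def by (auto simp: scalar_prod_def intro!: sum.neutral)
  ultimately show False using nN by simp
qed

lemma UN_const2:
  "A \<noteq> {} \<Longrightarrow> B \<noteq> {} \<Longrightarrow> (\<And>a b. a \<in> A \<Longrightarrow> b \<in> B \<Longrightarrow> F a b = K) \<Longrightarrow>
   (\<Union>a\<in>A. \<Union>b\<in>B. F a b) = K"
  by auto

section \<open>Cosets and the correspondence of ideals\<close>

context assoc_algebra
begin

definition cls :: "'a set \<Rightarrow> 'a \<Rightarrow> 'a set" where
  "cls J x = (+) x ` J"

lemma cls_eq_iff: "subspace J \<Longrightarrow> cls J x = cls J y \<longleftrightarrow> x - y \<in> J"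
proof
  assume J: "subspace J" and eq: "cls J x = cls J y"
  have "x + 0 \<in> cls J x" unfolding cls_def using subspace_0[OF J] by blast
  then obtain j where "x = y + j" "j \<in> J" unfolding eq unfolding cls_def by auto
  then show "x - y \<in> J" by simp
next
  have *: "cls J x \<subseteq> cls J y" if J: "subspace J" and "x - y \<in> J" for x y
  proof
    fix z assume "z \<in> cls J x"
    then obtain j where "j \<in> J" "z = x + j" unfolding cls_def by blast
    then have "z = y + (x - y + j)" "x - y + j \<in> J" using that subspace_add by auto
    then show "z \<in> cls J y" unfolding cls_def by blast
  qed
  assume J: "subspace J" and "x - y \<in> J"
  moreover from this have "y - x \<in> J" using subspace_neg[OF J] by fastforce
  ultimately show "cls J x = cls J y" using * by blast
qed

lemma cls_0 [simp]: "cls J 0 = J"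
  unfolding cls_def by simp

lemma cls_nonempty: "subspace J \<Longrightarrow> cls J x \<noteq> {}"
  unfolding cls_def using subspace_0 by blast

lemma cls_diff: "x' \<in> cls J x \<Longrightarrow> x' - x \<in> J"
  unfolding cls_def by auto

lemma quotient_simps:
  assumes P: "subalgebra P" and J: "alg_ideal (alg_on P) J" and xy: "x \<in> P" "y \<in> P"
  defines "Q \<equiv> alg_quotient (alg_on P) J"
  shows "acarrier Q = cls J ` P" "azero Q = J"
    "aadd Q (cls J x) (cls J y) = cls J (x + y)"
    "amult Q (cls J x) (cls J y) = cls J (x * y)"
    "ascale Q c (cls J x) = cls J (scale c x)"
proof -
  note Ji = J[unfolded alg_ideal_alg_on_iff]
  have sJ: "subspace J" using Ji by blast
  have coset: "alg_coset (alg_on P) J = cls J"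
    by (rule ext) (simp add: alg_coset_def alg_on_def cls_def)
  show "acarrier Q = cls J ` P" "azero Q = J"
    unfolding Q_def alg_quotient_def coset by (auto simp: alg_on_def)
  show "aadd Q (cls J x) (cls J y) = cls J (x + y)"
  proof -
    have "cls J (a + b) = cls J (x + y)" if "a \<in> cls J x" "b \<in> cls J y" for a b
      unfolding cls_eq_iff[OF sJ]
      using subspace_add[OF sJ cls_diff[OF that(1)] cls_diff[OF that(2)]]
      by (simp add: algebra_simps)
    then show ?thesis
      unfolding Q_def alg_quotient_def coset using cls_nonempty[OF sJ]
      by (simp add: alg_on_def UN_const2)
  qed
  show "amult Q (cls J x) (cls J y) = cls J (x * y)"
  proof -
    have "cls J (a * b) = cls J (x * y)" if "a \<in> cls J x" "b \<in> cls J y" for a b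
    proof -
      have b: "b \<in> P"
        using that(2) xy(2) Ji subspace_add[OF subalgebra_subspace[OF P]] unfolding cls_def by auto
      have "(a - x) * b + x * (b - y) \<in> J"
        using cls_diff[OF that(1)] cls_diff[OF that(2)] Ji b xy(1) by (intro subspace_add[OF sJ]) auto
      then show ?thesis unfolding cls_eq_iff[OF sJ] by (simp add: algebra_simps)
    qed
    then show ?thesis
      unfolding Q_def alg_quotient_def coset using cls_nonempty[OF sJ]
      by (simp add: alg_on_def UN_const2)
  qed
  show "ascale Q c (cls J x) = cls J (scale c x)"
  proof -
    have "cls J (scale c a) = cls J (scale c x)" if "a \<in> cls J x" for a
      unfolding cls_eq_iff[OF sJ]
      using subspace_scale[OF sJ cls_diff[OF that], of c] by (simp add: scale_right_diff_distrib)
    then show ?thesis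
      unfolding Q_def alg_quotient_def coset using cls_nonempty[OF sJ, of x]
      by (simp add: alg_on_def)
  qed
qed

text \<open>The operations of a quotient are unions of cosets that do not refer to the carrier. A
  component of the quotient of \<open>P\<close> is therefore literally the quotient of its preimage
  \<open>D\<close>.\<close>

lemma quotient_restrict:
  "(alg_quotient (alg_on P) J)\<lparr>acarrier := cls J ` D\<rparr> = alg_quotient (alg_on D) J"
proof -
  have "alg_coset (alg_on P) J = cls J" for P
    by (rule ext) (simp add: alg_coset_def alg_on_def cls_def)
  then show ?thesis unfolding alg_quotient_def by (simp add: alg_on_def)
qed

lemma quotient_ideal_preimage:
  assumes P: "subalgebra P" and J: "alg_ideal (alg_on P) J"
    and C: "alg_ideal (alg_quotient (alg_on P) J) C"
  defines "D \<equiv> {x \<in> P. cls J x \<in> C}"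
  shows "alg_ideal (alg_on P) D" "J \<subseteq> D" "C = cls J ` D"
proof -
  note sP = subalgebra_subspace[OF P]
  note q = quotient_simps[OF P J]
  have sJ: "subspace J" and JP: "J \<subseteq> P" using J unfolding alg_ideal_alg_on_iff by auto
  have C1: "C \<subseteq> cls J ` P" "J \<in> C"
    using C q(1,2)[OF subspace_0[OF sP] subspace_0[OF sP]] unfolding alg_ideal_def by auto
  have C2: "cls J (x + y) \<in> C" if "x \<in> D" "y \<in> D" for x y
    using C that q(3)[of x y] unfolding alg_ideal_def D_def by (metis (no_types, lifting) mem_Collect_eq)
  have C3: "cls J (scale c x) \<in> C" if "x \<in> D" for c x
    using C that q(5)[of x x c] unfolding alg_ideal_def D_def by (metis (no_types, lifting) mem_Collect_eq)
  have C4: "cls J (a * x) \<in> C \<and> cls J (x * a) \<in> C" if "x \<in> D" "a \<in> P" for a x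
  proof -
    have "cls J a \<in> acarrier (alg_quotient (alg_on P) J)" "cls J x \<in> C"
      using q(1)[OF that(2,2)] that unfolding D_def by auto
    then have "amult (alg_quotient (alg_on P) J) (cls J a) (cls J x) \<in> C \<and>
      amult (alg_quotient (alg_on P) J) (cls J x) (cls J a) \<in> C"
      using C unfolding alg_ideal_def by blast
    then show ?thesis using q(4) that unfolding D_def by auto
  qed
  show "C = cls J ` D" using C1 unfolding D_def by auto
  have "cls J j \<in> C" if "j \<in> J" for j
    using cls_eq_iff[OF sJ, of j 0] that C1(2) by simp
  then show JD: "J \<subseteq> D" using JP unfolding D_def by auto
  show "alg_ideal (alg_on P) D"
    unfolding alg_ideal_alg_on_iff
  proof (intro conjI ballI)
    show "D \<subseteq> P" unfolding D_def by auto
    show "subspace D"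
    proof (rule subspaceI)
      show "0 \<in> D" using JD subspace_0[OF sJ] by auto
      show "x + y \<in> D" if "x \<in> D" "y \<in> D" for x y
        using C2[OF that] that subspace_add[OF sP] unfolding D_def by auto
      show "scale c x \<in> D" if "x \<in> D" for c x
        using C3[OF that] that subspace_scale[OF sP] unfolding D_def by auto
    qed
    fix a x assume "a \<in> P" "x \<in> D"
    then show "a * x \<in> D" "x * a \<in> D"
      using C4[of x a] subalgebra_mult[OF P] unfolding D_def by auto
  qed
qed

lemma quotient_ideal_image:
  assumes P: "subalgebra P" and J: "alg_ideal (alg_on P) J"
    and D: "alg_ideal (alg_on P) D"
  shows "alg_ideal (alg_quotient (alg_on P) J) (cls J ` D)"
proof -
  note Di = D[unfolded alg_ideal_alg_on_iff]
  have sD: "subspace D" and DP: "D \<subseteq> P" using Di by auto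
  note q = quotient_simps[OF P J]
  have P0: "0 \<in> P" using subspace_0[OF sD] DP by blast
  show ?thesis
    unfolding alg_ideal_def q(1)[OF P0 P0] q(2)[OF P0 P0]
  proof (intro conjI ballI allI)
    show "cls J ` D \<subseteq> cls J ` P" using DP by blast
    show "J \<in> cls J ` D" using subspace_0[OF sD] by (metis cls_0 imageI)
    fix X assume "X \<in> cls J ` D"
    then obtain x where x: "x \<in> D" "X = cls J x" by blast
    show "ascale (alg_quotient (alg_on P) J) c X \<in> cls J ` D" for c
      using q(5)[of x x] x DP subspace_scale[OF sD] by auto
    show "aadd (alg_quotient (alg_on P) J) X Y \<in> cls J ` D" if Y: "Y \<in> cls J ` D" for Y
    proof -
      obtain y where "y \<in> D" "Y = cls J y" using Y by blast
      then show ?thesis using q(3)[of x y] x DP subspace_add[OF sD, of x y] by auto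
    qed
    fix A assume "A \<in> cls J ` P"
    then obtain a where a: "a \<in> P" "A = cls J a" by blast
    show "amult (alg_quotient (alg_on P) J) A X \<in> cls J ` D"
      using q(4)[of a x] x a DP Di by auto
    show "amult (alg_quotient (alg_on P) J) X A \<in> cls J ` D"
      using q(4)[of x a] x a DP Di by auto
  qed
qed

text \<open>
  The identity \<open>c\<close> of a simple component is central modulo the radical, so \<open>x \<mapsto> c x c\<close> projects
  onto the component; it kills no member of \<open>E\<close> because each of them generates all of \<open>P\<close>.
\<close>
lemma component_rank_lower_bound:
  assumes P: "subalgebra P" and J: "alg_ideal (alg_on P) J"
    and E: "finite E" "orth_idempotents E" "E \<subseteq> P" "\<And>k. k \<in> E \<Longrightarrow> P \<subseteq> sandwich P k"
    and n: "n \<in> component_ranks (alg_quotient (alg_on P) J)"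
  shows "card E \<le> n"
proof -
  let ?Q = "alg_quotient (alg_on P) J"
  obtain C where C: "alg_ideal ?Q C" "simple_alg (?Q\<lparr>acarrier := C\<rparr>)"
    "alg_iso (?Q\<lparr>acarrier := C\<rparr>) (matrix_alg n)"
    using n unfolding component_ranks_def simple_component_def by blast
  define D where "D = {x \<in> P. cls J x \<in> C}"
  note D = quotient_ideal_preimage[OF P J C(1), folded D_def]
  note Di = D(1)[unfolded alg_ideal_alg_on_iff]
  note Ji = J[unfolded alg_ideal_alg_on_iff]
  have sJ: "subspace J" and sD: "subspace D" and DP: "D \<subseteq> P" using Ji Di by auto
  have D_alg: "subalgebra D" by (rule alg_ideal_subalgebra[OF D(1)])
  have JD: "alg_ideal (alg_on D) J" unfolding alg_ideal_alg_on_iff using Ji D(2) DP by blast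
  have D0: "0 \<in> D" by (rule subspace_0[OF sD])
  define R where "R = alg_quotient (alg_on D) J"
  have R: "?Q\<lparr>acarrier := C\<rparr> = R" unfolding D(3) R_def by (rule quotient_restrict)
  note q = quotient_simps[OF D_alg JD, folded R_def]
  \<comment> \<open>Simplicity includes a nonzero product; it serves below to contradict the
    possibility that the identity of the component annihilates everything.\<close>
  obtain x\<^sub>0 y\<^sub>0 where xy0: "x\<^sub>0 \<in> D" "y\<^sub>0 \<in> D" "x\<^sub>0 * y\<^sub>0 \<notin> J"
  proof -
    obtain X Y where XY: "X \<in> cls J ` D" "Y \<in> cls J ` D" "amult R X Y \<noteq> J"
      using C(2)[unfolded R simple_alg_def] q(1,2)[OF D0 D0] by auto
    then obtain x y where "x \<in> D" "y \<in> D" "X = cls J x" "Y = cls J y" by blast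
    moreover have "cls J (x * y) \<noteq> cls J 0" using calculation XY(3) q(4)[of x y] by simp
    ultimately show thesis using that cls_eq_iff[OF sJ, of "x * y" 0] by simp
  qed
  obtain \<phi> where bij: "bij_betw \<phi> (cls J ` D) (carrier_mat n n :: 'f mat set)"
    and hom: "\<forall>x\<in>D. \<forall>y\<in>D. \<phi> (aadd R (cls J x) (cls J y)) = \<phi> (cls J x) + \<phi> (cls J y) \<and>
      \<phi> (amult R (cls J x) (cls J y)) = \<phi> (cls J x) * \<phi> (cls J y)"
    using C(3)[unfolded R alg_iso_def] unfolding q(1)[OF D0 D0] by (auto simp: matrix_alg_def)
  define \<Phi> where "\<Phi> x = \<phi> (cls J x)" for x
  have \<Phi>c: "\<Phi> x \<in> carrier_mat n n" if "x \<in> D" for x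
    using bij that unfolding \<Phi>_def bij_betw_def by blast
  have \<Phi>_mult: "\<Phi> (x * y) = \<Phi> x * \<Phi> y" if "x \<in> D" "y \<in> D" for x y
    using hom q(4)[OF that] that unfolding \<Phi>_def by metis
  have \<Phi>_add: "\<Phi> (x + y) = \<Phi> x + \<Phi> y" if "x \<in> D" "y \<in> D" for x y
    using hom q(3)[OF that] that unfolding \<Phi>_def by metis
  have \<Phi>_eq: "\<Phi> x = \<Phi> y \<longleftrightarrow> x - y \<in> J" if "x \<in> D" "y \<in> D" for x y
    using inj_on_eq_iff[OF bij_betw_imp_inj_on[OF bij]] that cls_eq_iff[OF sJ, of x y]
    unfolding \<Phi>_def by simp
  \<comment> \<open>\<open>alg_iso\<close> does not ask for preservation of zero; it follows from
    additivity by cancelling entries.\<close>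
  have \<Phi>_0: "\<Phi> 0 = 0\<^sub>m n n"
  proof -
    have "\<Phi> 0 = \<Phi> 0 + \<Phi> 0" using \<Phi>_add[OF D0 D0] by simp
    then have "\<Phi> 0 $$ (i, j) = 0" if "i < n" "j < n" for i j
      using \<Phi>c[OF D0] that by (metis add_cancel_right_right carrier_matD index_add_mat(1))
    then show ?thesis using \<Phi>c[OF D0] by (intro eq_matI) auto
  qed
  have "1\<^sub>m n \<in> \<phi> ` (cls J ` D)" using bij unfolding bij_betw_def by simp
  then obtain c where c: "c \<in> D" "\<Phi> c = 1\<^sub>m n" unfolding \<Phi>_def by force
  have cP: "c \<in> P" using c(1) DP by blast
  have DPm: "x * a \<in> D" "a * x \<in> D" if "x \<in> D" "a \<in> P" for a x using Di that by auto
  have cx: "\<Phi> (c * x) = \<Phi> x" "\<Phi> (x * c) = \<Phi> x" if "x \<in> D" for x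
    using \<Phi>_mult[OF c(1) that] \<Phi>_mult[OF that c(1)] \<Phi>c[OF that] c(2) by auto
  define T where "T k = \<Phi> (c * k)" for k
  have T': "T k = \<Phi> (k * c)" if "k \<in> P" for k
  proof -
    have "\<Phi> (c * k) = \<Phi> (c * k * c)" using cx(2)[of "c * k"] DPm[OF c(1) that] by simp
    also have "\<dots> = \<Phi> (k * c)" using cx(1)[of "k * c"] DPm[OF c(1) that] by (simp add: mult.assoc)
    finally show ?thesis unfolding T_def .
  qed
  have T_mult: "T k * T m = T (k * m)" if "k \<in> P" "m \<in> P" for k m
  proof -
    have "T k * T m = \<Phi> (c * k * (m * c))"
      unfolding T'[OF that(2)] unfolding T_def using \<Phi>_mult DPm[OF c(1)] that by simp
    also have "\<dots> = \<Phi> (c * ((k * m) * c))" by (simp only: mult.assoc)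
    also have "\<dots> = T (k * m)"
      using cx(1) T'[of "k * m"] DPm[OF c(1)] subalgebra_mult[OF P that] by simp
    finally show ?thesis .
  qed
  have Tc: "T k \<in> carrier_mat n n" if "k \<in> P" for k
    unfolding T_def using \<Phi>c DPm[OF c(1) that] by blast
  have T0: "T k \<noteq> 0\<^sub>m n n" if k: "k \<in> E" for k
  proof
    assume Tk: "T k = 0\<^sub>m n n"
    have "c * x \<in> J" if "x \<in> P" for x
    proof (rule sandwich_mult_left_least[OF sJ])
      show "x \<in> sandwich P k" using E(4)[OF k] that by blast
      fix a b assume ab: "a \<in> P" "b \<in> P"
      have kP: "k \<in> P" using E(3) k by blast
      have "T (a * k * b) = T a * T k * T b"
        using T_mult ab kP subalgebra_mult[OF P] by metis
      also have "\<dots> = \<Phi> 0" unfolding Tk \<Phi>_0 using Tc[OF ab(1)] Tc[OF ab(2)] by simp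
      finally have "\<Phi> (c * (a * k * b)) = \<Phi> 0" unfolding T_def .
      then show "c * (a * k * b) \<in> J"
        using \<Phi>_eq[of "c * (a * k * b)" 0] D0 DPm(1)[OF c(1), of "a * k * b"] ab kP
          subalgebra_mult[OF P] by simp
    qed
    then have "\<Phi> x\<^sub>0 = \<Phi> 0" using cx(1)[OF xy0(1)] \<Phi>_eq[of "c * x\<^sub>0" 0] D0 xy0(1) DP c(1) DPm by auto
    then have "x\<^sub>0 \<in> J" using \<Phi>_eq[OF xy0(1) D0] by simp
    then show False using xy0 Ji DP by blast
  qed
  obtain h where h: "bij_betw h {..<card E} E"
    using ex_bij_betw_nat_finite[OF E(1)] by (auto simp: atLeast0LessThan)
  have hE: "h k \<in> E" if "k < card E" for k using h that unfolding bij_betw_def by blast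
  have T_0: "T 0 = 0\<^sub>m n n" unfolding T_def using \<Phi>_0 by simp
  show ?thesis
  proof (rule orth_idempotent_matrices_card[of "card E" "T \<circ> h"])
    fix k assume k: "k < card E"
    show "(T \<circ> h) k \<in> carrier_mat n n" "(T \<circ> h) k \<noteq> 0\<^sub>m n n"
      using Tc T0 hE[OF k] E(3) by auto
    show "(T \<circ> h) k * (T \<circ> h) k = (T \<circ> h) k"
      using T_mult[of "h k" "h k"] hE[OF k] E(2,3) unfolding orth_idempotents_def by auto
    fix m assume m: "m < card E" "k \<noteq> m"
    then have "h k \<noteq> h m" using h k unfolding bij_betw_def inj_on_def by blast
    then have "h k * h m = 0" using hE k m E(2) unfolding orth_idempotents_def by blast
    then show "(T \<circ> h) k * (T \<circ> h) m = 0\<^sub>m n n"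
      using T_mult[of "h k" "h m"] hE k m E(3) T_0 by auto
  qed
qed

end

section \<open>Existence of a matrix component\<close>

lemma index_mult_mat_sum:
  "A \<in> carrier_mat n n \<Longrightarrow> B \<in> carrier_mat n n \<Longrightarrow> i < n \<Longrightarrow> j < n \<Longrightarrow>
   (A * B) $$ (i, j) = (\<Sum>k<n. A $$ (i, k) * B $$ (k, j))"
  by (auto simp: scalar_prod_def atLeast0LessThan)

section \<open>Nondegeneracy of the pairing of e P with P e modulo the radical\<close>

context assoc_algebra
begin

text \<open>The \<open>y\<close> in question form a set \<open>L\<close> stable under left
  multiplication, so \<open>L P\<close> is an ideal. Its square lies in the radical, since v b z = v
  (e b z) for v, z in \<open>L\<close>; hence so does \<open>L P\<close>, which contains y = y
  e.\<close>

lemma radical_nondegenerate_left: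
  assumes P: "subalgebra P" "fin_dim P" and e: "e \<in> P"
    and y: "y \<in> P" "y * e = y" "\<And>c. c \<in> P \<Longrightarrow> e * c * y \<in> radical P"
  shows "y \<in> radical P"
proof -
  define J where "J = radical P"
  note Ji = radical_ideal[OF P, folded J_def, unfolded alg_ideal_alg_on_iff]
  have sJ: "subspace J" using Ji by blast
  note mP = subalgebra_mult[OF P(1)]
  define L where "L = {y \<in> P. y * e = y \<and> (\<forall>c\<in>P. e * c * y \<in> J)}"
  let ?I = "product_span L P"
  have aL: "a * y \<in> L" if "a \<in> P" "y \<in> L" for a y
    using that mP unfolding L_def by (auto simp: mult.assoc) (metis mult.assoc)
  have "alg_ideal (alg_on P) ?I"
    unfolding alg_ideal_alg_on_iff
  proof (intro conjI ballI)
    show "?I \<subseteq> P"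
      using mP by (intro product_span_least subalgebra_subspace[OF P(1)]) (auto simp: L_def)
    fix a x assume a: "a \<in> P" and x: "x \<in> ?I"
    show "a * x \<in> ?I"
      by (rule product_span_mult_left[OF _ _ x], simp, subst mult.assoc[symmetric])
        (auto intro: product_spanI aL a)
    show "x * a \<in> ?I"
      by (rule product_span_mult_right[OF _ _ x], simp, subst mult.assoc)
        (auto intro: product_spanI mP a)
  qed simp
  moreover have "x * x' \<in> radical P" if x: "x \<in> ?I" and x': "x' \<in> ?I" for x x'
  proof (rule product_span_mult_left[OF _ _ x'])
    show "subspace (radical P)" using sJ unfolding J_def .
    fix z b' assume z: "z \<in> L" "b' \<in> P"
    show "x * (z * b') \<in> radical P"
    proof (rule product_span_mult_right[OF _ _ x])
      show "subspace (radical P)" using sJ unfolding J_def .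
      fix v b assume v: "v \<in> L" "b \<in> P"
      have "v * b * (z * b') = (v * e) * b * (z * b')" using v(1) unfolding L_def by simp
      then have "v * b * (z * b') = v * (e * b * z) * b'" by (simp only: mult.assoc)
      moreover have "v * (e * b * z) * b' \<in> J" using v z Ji unfolding L_def by auto
      ultimately show "v * b * (z * b') \<in> radical P" unfolding J_def by simp
    qed
  qed
  ultimately have "?I \<subseteq> radical P" by (rule radical_square[OF P])
  moreover have "y * e \<in> ?I" by (rule product_spanI) (use y e in \<open>auto simp: L_def J_def\<close>)
  ultimately show ?thesis using y(2) by auto
qed

lemma radical_nondegenerate_right:
  assumes P: "subalgebra P" "fin_dim P" and e: "e \<in> P"
    and y: "y \<in> P" "e * y = y" "\<And>c. c \<in> P \<Longrightarrow> y * c * e \<in> radical P"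
  shows "y \<in> radical P"
proof -
  define J where "J = radical P"
  note Ji = radical_ideal[OF P, folded J_def, unfolded alg_ideal_alg_on_iff]
  have sJ: "subspace J" using Ji by blast
  note mP = subalgebra_mult[OF P(1)]
  define L where "L = {y \<in> P. e * y = y \<and> (\<forall>c\<in>P. y * c * e \<in> J)}"
  let ?I = "product_span P L"
  have aL: "y * a \<in> L" if "a \<in> P" "y \<in> L" for a y
    using that mP unfolding L_def by (auto simp: mult.assoc) (metis mult.assoc)+
  have "alg_ideal (alg_on P) ?I"
    unfolding alg_ideal_alg_on_iff
  proof (intro conjI ballI)
    show "?I \<subseteq> P"
      using mP by (intro product_span_least subalgebra_subspace[OF P(1)]) (auto simp: L_def)
    fix a x assume a: "a \<in> P" and x: "x \<in> ?I"
    show "a * x \<in> ?I"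
      by (rule product_span_mult_left[OF _ _ x], simp, subst mult.assoc[symmetric])
        (auto intro: product_spanI mP a)
    show "x * a \<in> ?I"
      by (rule product_span_mult_right[OF _ _ x], simp, subst mult.assoc)
        (auto intro: product_spanI aL a)
  qed simp
  moreover have "x * x' \<in> radical P" if x: "x \<in> ?I" and x': "x' \<in> ?I" for x x'
  proof (rule product_span_mult_left[OF _ _ x'])
    show "subspace (radical P)" using sJ unfolding J_def .
    fix b' z assume z: "b' \<in> P" "z \<in> L"
    show "x * (b' * z) \<in> radical P"
    proof (rule product_span_mult_right[OF _ _ x])
      show "subspace (radical P)" using sJ unfolding J_def .
      fix b v assume v: "b \<in> P" "v \<in> L"
      have "b * v * (b' * z) = b * v * (b' * (e * z))" using z(2) unfolding L_def by simp
      then have "b * v * (b' * z) = b * (v * b' * e) * z" by (simp only: mult.assoc)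
      moreover have "b * (v * b' * e) * z \<in> J" using v z Ji unfolding L_def by auto
      ultimately show "b * v * (b' * z) \<in> radical P" unfolding J_def by simp
    qed
  qed
  ultimately have "?I \<subseteq> radical P" by (rule radical_square[OF P])
  moreover have "e * y \<in> ?I" by (rule product_spanI) (use y e in \<open>auto simp: L_def J_def\<close>)
  ultimately show ?thesis using y(2) by auto
qed

end

text \<open>
  Think of \<open>u\<close> and \<open>w\<close> as dual bases of \<open>P e\<close> and \<open>e P\<close> modulo \<open>J\<close>, for the pairing
  \<open>e P \<times> P e \<rightarrow> e P e\<close>, which modulo \<open>J\<close> takes values in the multiples of \<open>e\<close>.
\<close>
locale dual_system = assoc_algebra scale
  for scale :: "'f :: field \<Rightarrow> 'a :: ring \<Rightarrow> 'a" +
  fixes P J :: "'a set" and e :: 'a and n :: nat and u w :: "nat \<Rightarrow> 'a"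
  assumes P: "subalgebra P" and J: "alg_ideal (alg_on P) J"
    and e: "e \<in> P" "e * e = e" "e \<notin> J"
    and corner: "\<And>x. x \<in> P \<Longrightarrow> e * x = x \<Longrightarrow> x * e = x \<Longrightarrow> \<exists>r. x - scale r e \<in> J"
    and u: "\<And>i. i < n \<Longrightarrow> u i \<in> P" "\<And>i. i < n \<Longrightarrow> u i * e = u i"
    and w: "\<And>i. i < n \<Longrightarrow> w i \<in> P" "\<And>i. i < n \<Longrightarrow> e * w i = w i"
    and dual: "\<And>i j. i < n \<Longrightarrow> j < n \<Longrightarrow> w i * u j - (if i = j then e else 0) \<in> J"
    and complete_left: "\<And>y. y \<in> P \<Longrightarrow> y * e = y \<Longrightarrow> \<forall>i<n. w i * y \<in> J \<Longrightarrow> y \<in> J"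
    and complete_right: "\<And>y. y \<in> P \<Longrightarrow> e * y = y \<Longrightarrow> \<forall>i<n. y * u i \<in> J \<Longrightarrow> y \<in> J"
    and n_pos: "0 < n"
begin

lemma subspace_P: "subspace P" and subspace_J: "subspace J" and J_subset: "J \<subseteq> P"
  and J_mult: "\<And>a x. a \<in> P \<Longrightarrow> x \<in> J \<Longrightarrow> a * x \<in> J" "\<And>a x. a \<in> P \<Longrightarrow> x \<in> J \<Longrightarrow> x * a \<in> J"
  and P_mult: "\<And>a b. a \<in> P \<Longrightarrow> b \<in> P \<Longrightarrow> a * b \<in> P"
  using P J unfolding alg_ideal_alg_on_iff subalgebra_def by auto

definition eqv :: "'a \<Rightarrow> 'a \<Rightarrow> bool" (infix "\<approx>" 50) where
  "x \<approx> y \<longleftrightarrow> x - y \<in> J"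

lemma eqv_refl [simp]: "x \<approx> x"
  unfolding eqv_def using subspace_0[OF subspace_J] by simp

lemma eqv_sym: "x \<approx> y \<Longrightarrow> y \<approx> x"
  unfolding eqv_def using subspace_neg[OF subspace_J, of "x - y"] by simp

lemma eqv_trans [trans]: "x \<approx> y \<Longrightarrow> y \<approx> z \<Longrightarrow> x \<approx> z"
  unfolding eqv_def using subspace_add[OF subspace_J, of "x - y" "y - z"] by simp

lemma eqv_eq_trans [trans]: "x \<approx> y \<Longrightarrow> y = z \<Longrightarrow> x \<approx> z"
  and eq_eqv_trans [trans]: "x = y \<Longrightarrow> y \<approx> z \<Longrightarrow> x \<approx> z"
  by simp_all

lemma eqv_diff: "x \<approx> y \<Longrightarrow> x' \<approx> y' \<Longrightarrow> x - x' \<approx> y - y'"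
  unfolding eqv_def using subspace_diff[OF subspace_J, of "x - y" "x' - y'"]
  by (simp add: algebra_simps)

lemma eqv_scale: "x \<approx> y \<Longrightarrow> scale c x \<approx> scale c y"
  unfolding eqv_def using subspace_scale[OF subspace_J, of "x - y" c]
  by (simp add: scale_right_diff_distrib)

lemma eqv_sum: "(\<And>i. i \<in> S \<Longrightarrow> f i \<approx> g i) \<Longrightarrow> sum f S \<approx> sum g S"
  unfolding eqv_def sum_subtractf[symmetric] by (rule subspace_sum[OF subspace_J])

lemma eqv_mult_left: "x \<approx> y \<Longrightarrow> a \<in> P \<Longrightarrow> a * x \<approx> a * y"
  unfolding eqv_def using J_mult(1) by (simp flip: right_diff_distrib)

lemma eqv_mult_right: "x \<approx> y \<Longrightarrow> a \<in> P \<Longrightarrow> x * a \<approx> y * a"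
  unfolding eqv_def using J_mult(2) by (simp flip: left_diff_distrib)

lemma eqv_0_iff: "x \<approx> 0 \<longleftrightarrow> x \<in> J"
  unfolding eqv_def by simp

lemma scale_e_eqv_iff: "scale r e \<approx> scale s e \<longleftrightarrow> r = s"
proof
  assume "scale r e \<approx> scale s e"
  then have *: "scale (r - s) e \<in> J" unfolding eqv_def by (simp add: scale_left_diff_distrib)
  show "r = s"
  proof (rule ccontr)
    assume "r \<noteq> s"
    then have "e = scale (inverse (r - s)) (scale (r - s) e)" by simp
    then show False using subspace_scale[OF subspace_J *] e(3) by metis
  qed
qed simp

text \<open>The matrix of left multiplication by \<open>p\<close> on \<open>P e\<close> modulo
  \<open>J\<close>, in the basis \<open>u\<close>. Its entries exist by \<open>corner\<close>; they
  are unique because \<open>e\<close> is not in \<open>J\<close>.\<close>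

definition rep :: "'a \<Rightarrow> 'f mat" where
  "rep p = mat n n (\<lambda>(k, l). SOME r. w k * p * u l \<approx> scale r e)"

lemma rep_carrier [simp]: "rep p \<in> carrier_mat n n"
  unfolding rep_def by simp

lemma rep_eqv:
  assumes "p \<in> P" "k < n" "l < n"
  shows "w k * p * u l \<approx> scale (rep p $$ (k, l)) e"
proof -
  have "w k * p * u l \<in> P" using assms u w P_mult by auto
  moreover have "e * (w k * p * u l) = w k * p * u l" using w(2)[OF assms(2)] by (simp flip: mult.assoc)
  moreover have "w k * p * u l * e = w k * p * u l" using u(2)[OF assms(3)] by (simp add: mult.assoc)
  ultimately have "\<exists>r. w k * p * u l \<approx> scale r e" using corner unfolding eqv_def by blast
  then have "w k * p * u l \<approx> scale (SOME r. w k * p * u l \<approx> scale r e) e" by (rule someI_ex)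
  then show ?thesis using assms unfolding rep_def by simp
qed

lemma rep_eqI:
  assumes "p \<in> P" "A \<in> carrier_mat n n"
    and "\<And>k l. k < n \<Longrightarrow> l < n \<Longrightarrow> w k * p * u l \<approx> scale (A $$ (k, l)) e"
  shows "rep p = A"
proof (rule eq_matI)
  fix k l assume "k < dim_row A" "l < dim_col A"
  then have kl: "k < n" "l < n" using assms(2) by auto
  then have "scale (rep p $$ (k, l)) e \<approx> scale (A $$ (k, l)) e"
    using eqv_trans[OF eqv_sym[OF rep_eqv] assms(3)] assms(1) by blast
  then show "rep p $$ (k, l) = A $$ (k, l)" unfolding scale_e_eqv_iff .
qed (use assms(2) in \<open>auto simp: rep_def\<close>)

lemma dual_eqv: "i < n \<Longrightarrow> j < n \<Longrightarrow> w i * u j \<approx> (if i = j then e else 0)"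
  unfolding eqv_def by (rule dual)

text \<open>Duality shows that the difference of the two sides pairs into \<open>J\<close> with
  every \<open>w i\<close>; \<open>complete_left\<close> then puts it into \<open>J\<close>.\<close>

lemma mult_u_eqv:
  assumes "p \<in> P" "l < n"
  shows "p * u l \<approx> (\<Sum>k<n. scale (rep p $$ (k, l)) (u k))"
  unfolding eqv_def
proof (rule complete_left)
  let ?y = "p * u l - (\<Sum>k<n. scale (rep p $$ (k, l)) (u k))"
  show "?y \<in> P"
    using assms u subspace_P P_mult
    by (auto intro!: subspace_diff subspace_sum subspace_scale)
  show "?y * e = ?y"
    using u assms
    by (simp add: left_diff_distrib mult.assoc sum_distrib_right scale_mult_left[symmetric])
  show "\<forall>i<n. w i * ?y \<in> J"
  proof (intro allI impI)
    fix i assume i: "i < n"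
    have "(\<Sum>k<n. scale (rep p $$ (k, l)) (if i = k then e else 0)) =
        (\<Sum>k<n. if i = k then scale (rep p $$ (k, l)) e else 0)"
      by (rule sum.cong) auto
    also have "\<dots> = scale (rep p $$ (i, l)) e" using i by simp
    finally have s: "(\<Sum>k<n. scale (rep p $$ (k, l)) (if i = k then e else 0)) =
        scale (rep p $$ (i, l)) e" .
    have "w i * ?y = w i * p * u l - (\<Sum>k<n. scale (rep p $$ (k, l)) (w i * u k))"
      by (simp add: right_diff_distrib mult.assoc sum_distrib_left scale_mult_right[symmetric])
    also have "\<dots> \<approx> scale (rep p $$ (i, l)) e -
        (\<Sum>k<n. scale (rep p $$ (k, l)) (if i = k then e else 0))"
      using i assms by (intro eqv_diff rep_eqv eqv_sum eqv_scale dual_eqv) auto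
    also have "\<dots> = 0" unfolding s by simp
    finally show "w i * ?y \<in> J" unfolding eqv_0_iff .
  qed
qed

text \<open>The same matrix describes right multiplication on the \<open>w\<close>, now through its
  rows. This is what makes the span of the \<open>u i * w j\<close> a two-sided ideal modulo
  \<open>J\<close>.\<close>

lemma w_mult_eqv:
  assumes "p \<in> P" "k < n"
  shows "w k * p \<approx> (\<Sum>l<n. scale (rep p $$ (k, l)) (w l))"
  unfolding eqv_def
proof (rule complete_right)
  let ?y = "w k * p - (\<Sum>l<n. scale (rep p $$ (k, l)) (w l))"
  show "?y \<in> P"
    using assms w subspace_P P_mult
    by (auto intro!: subspace_diff subspace_sum subspace_scale)
  show "e * ?y = ?y"
    using w assms
    by (simp add: right_diff_distrib mult.assoc[symmetric] sum_distrib_left scale_mult_right[symmetric])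
  show "\<forall>i<n. ?y * u i \<in> J"
  proof (intro allI impI)
    fix i assume i: "i < n"
    have "(\<Sum>l<n. scale (rep p $$ (k, l)) (if l = i then e else 0)) =
        (\<Sum>l<n. if l = i then scale (rep p $$ (k, l)) e else 0)"
      by (rule sum.cong) auto
    also have "\<dots> = scale (rep p $$ (k, i)) e" using i by simp
    finally have s: "(\<Sum>l<n. scale (rep p $$ (k, l)) (if l = i then e else 0)) =
        scale (rep p $$ (k, i)) e" .
    have "?y * u i = w k * p * u i - (\<Sum>l<n. scale (rep p $$ (k, l)) (w l * u i))"
      by (simp add: left_diff_distrib sum_distrib_right scale_mult_left[symmetric])
    also have "\<dots> \<approx> scale (rep p $$ (k, i)) e -
        (\<Sum>l<n. scale (rep p $$ (k, l)) (if l = i then e else 0))"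
      using i assms by (intro eqv_diff rep_eqv eqv_sum eqv_scale dual_eqv) auto
    also have "\<dots> = 0" unfolding s by simp
    finally show "?y * u i \<in> J" unfolding eqv_0_iff .
  qed
qed

section \<open>Matrices inside P modulo J, with \<open>u i * w j\<close> as matrix units\<close>

definition of_matrix :: "'f mat \<Rightarrow> 'a" where
  "of_matrix A = (\<Sum>i<n. \<Sum>j<n. scale (A $$ (i, j)) (u i * w j))"

lemma of_matrix_in_subspace:
  assumes "subspace V" "\<And>i j. i < n \<Longrightarrow> j < n \<Longrightarrow> u i * w j \<in> V"
  shows "of_matrix A \<in> V"
  unfolding of_matrix_def using assms by (auto intro!: subspace_sum subspace_scale)

lemma of_matrix_P: "of_matrix A \<in> P"
  using u w P_mult subspace_P by (intro of_matrix_in_subspace) auto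

lemma of_matrix_add:
  "A \<in> carrier_mat n n \<Longrightarrow> B \<in> carrier_mat n n \<Longrightarrow> of_matrix (A + B) = of_matrix A + of_matrix B"
  unfolding of_matrix_def by (simp add: scale_left_distrib sum.distrib)

lemma of_matrix_scale: "A \<in> carrier_mat n n \<Longrightarrow> of_matrix (c \<cdot>\<^sub>m A) = scale c (of_matrix A)"
  unfolding of_matrix_def by (simp add: scale_sum_right)

lemma of_matrix_0: "of_matrix (0\<^sub>m n n) = 0"
  unfolding of_matrix_def by simp

lemma mult_of_matrix:
  assumes "p \<in> P" "A \<in> carrier_mat n n"
  shows "p * of_matrix A \<approx> of_matrix (rep p * A)"
proof -
  have "p * of_matrix A = (\<Sum>i<n. \<Sum>j<n. scale (A $$ (i, j)) ((p * u i) * w j))"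
    unfolding of_matrix_def
    by (simp add: sum_distrib_left scale_mult_right[symmetric] mult.assoc)
  also have "\<dots> \<approx> (\<Sum>i<n. \<Sum>j<n. scale (A $$ (i, j)) ((\<Sum>k<n. scale (rep p $$ (k, i)) (u k)) * w j))"
    using assms w by (intro eqv_sum eqv_scale eqv_mult_right mult_u_eqv) auto
  also have "\<dots> = (\<Sum>i<n. \<Sum>j<n. \<Sum>k<n. scale (rep p $$ (k, i) * A $$ (i, j)) (u k * w j))"
    by (simp add: sum_distrib_right scale_mult_left[symmetric] scale_sum_right mult.commute)
  also have "\<dots> = (\<Sum>i<n. \<Sum>k<n. \<Sum>j<n. scale (rep p $$ (k, i) * A $$ (i, j)) (u k * w j))"
    by (intro sum.cong refl sum.swap)
  also have "\<dots> = (\<Sum>k<n. \<Sum>i<n. \<Sum>j<n. scale (rep p $$ (k, i) * A $$ (i, j)) (u k * w j))"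
    by (rule sum.swap)
  also have "\<dots> = (\<Sum>k<n. \<Sum>j<n. \<Sum>i<n. scale (rep p $$ (k, i) * A $$ (i, j)) (u k * w j))"
    by (intro sum.cong refl sum.swap)
  also have "\<dots> = of_matrix (rep p * A)"
    unfolding of_matrix_def using assms(2)
    by (intro sum.cong refl) (simp add: index_mult_mat_sum[where n = n] scale_sum_left)
  finally show ?thesis .
qed

lemma of_matrix_mult:
  assumes "p \<in> P" "A \<in> carrier_mat n n"
  shows "of_matrix A * p \<approx> of_matrix (A * rep p)"
proof -
  have "of_matrix A * p = (\<Sum>i<n. \<Sum>j<n. scale (A $$ (i, j)) (u i * (w j * p)))"
    unfolding of_matrix_def
    by (simp add: sum_distrib_right scale_mult_left[symmetric] mult.assoc)
  also have "\<dots> \<approx> (\<Sum>i<n. \<Sum>j<n. scale (A $$ (i, j)) (u i * (\<Sum>k<n. scale (rep p $$ (j, k)) (w k))))"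
    using assms u by (intro eqv_sum eqv_scale eqv_mult_left w_mult_eqv) auto
  also have "\<dots> = (\<Sum>i<n. \<Sum>j<n. \<Sum>k<n. scale (A $$ (i, j) * rep p $$ (j, k)) (u i * w k))"
    by (simp add: sum_distrib_left scale_mult_right[symmetric] scale_sum_right)
  also have "\<dots> = (\<Sum>i<n. \<Sum>k<n. \<Sum>j<n. scale (A $$ (i, j) * rep p $$ (j, k)) (u i * w k))"
    by (intro sum.cong refl sum.swap)
  also have "\<dots> = of_matrix (A * rep p)"
    unfolding of_matrix_def using assms(2)
    by (intro sum.cong refl) (simp add: index_mult_mat_sum[where n = n] scale_sum_left)
  finally show ?thesis .
qed

lemma w_of_matrix_u:
  assumes "A \<in> carrier_mat n n" "k < n" "l < n"
  shows "w k * of_matrix A * u l \<approx> scale (A $$ (k, l)) e"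
proof -
  have "w k * of_matrix A * u l = (\<Sum>i<n. \<Sum>j<n. scale (A $$ (i, j)) (w k * u i * (w j * u l)))"
    unfolding of_matrix_def
    by (simp add: sum_distrib_left sum_distrib_right scale_mult_left[symmetric]
        scale_mult_right[symmetric] mult.assoc)
  also have "\<dots> \<approx> (\<Sum>i<n. \<Sum>j<n. scale (A $$ (i, j))
      ((if k = i then e else 0) * (w j * u l)))"
    using assms u w P_mult by (intro eqv_sum eqv_scale eqv_mult_right dual_eqv) auto
  also have "\<dots> \<approx> (\<Sum>i<n. \<Sum>j<n. scale (A $$ (i, j))
      ((if k = i then e else 0) * (if j = l then e else 0)))"
    using assms e subspace_0[OF subspace_P] by (intro eqv_sum eqv_scale eqv_mult_left dual_eqv) auto
  also have "\<dots> = (\<Sum>i<n. \<Sum>j<n. if k = i \<and> j = l then scale (A $$ (i, j)) e else 0)"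
    using e(2) by (intro sum.cong refl) auto
  also have "\<dots> = (\<Sum>i<n. if k = i then (\<Sum>j<n. if j = l then scale (A $$ (i, j)) e else 0) else 0)"
    by (intro sum.cong refl) auto
  also have "\<dots> = scale (A $$ (k, l)) e" using assms by simp
  finally show ?thesis .
qed

lemma rep_of_matrix: "A \<in> carrier_mat n n \<Longrightarrow> rep (of_matrix A) = A"
  by (rule rep_eqI[OF of_matrix_P _ w_of_matrix_u])

lemma of_matrix_eqv_iff:
  assumes "A \<in> carrier_mat n n" "B \<in> carrier_mat n n"
  shows "of_matrix A \<approx> of_matrix B \<longleftrightarrow> A = B"
proof
  assume AB: "of_matrix A \<approx> of_matrix B"
  have "rep (of_matrix A) = B"
  proof (rule rep_eqI[OF of_matrix_P assms(2)])
    fix k l assume "k < n" "l < n"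
    then show "w k * of_matrix A * u l \<approx> scale (B $$ (k, l)) e"
      using eqv_trans[OF _ w_of_matrix_u[OF assms(2)]] AB u w
      by (meson eqv_mult_left eqv_mult_right)
  qed
  then show "A = B" using rep_of_matrix[OF assms(1)] by simp
qed simp

lemma of_matrix_unit:
  assumes "i < n" "j < n"
  shows "\<exists>A\<in>carrier_mat n n. of_matrix A = u i * w j"
proof
  let ?A = "mat n n (\<lambda>(a, b). if a = i \<and> b = j then 1 else 0) :: 'f mat"
  have "of_matrix ?A = (\<Sum>a<n. \<Sum>b<n. if a = i \<and> b = j then u a * w b else 0)"
    unfolding of_matrix_def by (intro sum.cong refl) auto
  also have "\<dots> = (\<Sum>a<n. if a = i then (\<Sum>b<n. if b = j then u a * w b else 0) else 0)"
    by (intro sum.cong refl) auto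
  finally show "of_matrix ?A = u i * w j" using assms by simp
qed simp

text \<open>Saturated under congruence modulo \<open>J\<close>, so that it is the full preimage in
  \<open>P\<close> of a component of the quotient.\<close>

definition component :: "'a set" where
  "component = {x \<in> P. \<exists>A\<in>carrier_mat n n. x \<approx> of_matrix A}"

lemma component_of_matrix: "A \<in> carrier_mat n n \<Longrightarrow> of_matrix A \<in> component"
  unfolding component_def using of_matrix_P eqv_refl by blast

lemma component_ideal: "alg_ideal (alg_on P) component" and J_component: "J \<subseteq> component"
proof -
  have J0: "x \<approx> of_matrix (0\<^sub>m n n)" if "x \<in> J" for x
    using that unfolding of_matrix_0 eqv_0_iff .
  show "J \<subseteq> component"
  proof
    fix x assume "x \<in> J"
    then show "x \<in> component"
      using J0 J_subset zero_carrier_mat[of n n] unfolding component_def by blast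
  qed
  show "alg_ideal (alg_on P) component"
    unfolding alg_ideal_alg_on_iff
  proof (intro conjI ballI)
    show "component \<subseteq> P" unfolding component_def by blast
    show "subspace component"
    proof (rule subspaceI)
      show "0 \<in> component" using \<open>J \<subseteq> component\<close> subspace_0[OF subspace_J] by blast
      fix x y assume x: "x \<in> component"
      then obtain A where A: "x \<in> P" "A \<in> carrier_mat n n" "x \<approx> of_matrix A"
        unfolding component_def by blast
      have "scale c x \<approx> of_matrix (c \<cdot>\<^sub>m A)" for c
        unfolding of_matrix_scale[OF A(2)] by (rule eqv_scale[OF A(3)])
      then show "scale c x \<in> component" for c
        using A subspace_scale[OF subspace_P] smult_carrier_mat[OF A(2), of c]
        unfolding component_def by blast
      assume "y \<in> component"
      then obtain B where B: "y \<in> P" "B \<in> carrier_mat n n" "y \<approx> of_matrix B"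
        unfolding component_def by blast
      have "x + y \<approx> of_matrix (A + B)"
        unfolding of_matrix_add[OF A(2) B(2)] eqv_def
        using subspace_add[OF subspace_J A(3)[unfolded eqv_def] B(3)[unfolded eqv_def]]
        by (simp add: algebra_simps)
      then show "x + y \<in> component"
        using A B subspace_add[OF subspace_P] add_carrier_mat[OF B(2), of A]
        unfolding component_def by blast
    qed
    fix p x assume p: "p \<in> P" and "x \<in> component"
    then obtain A where A: "x \<in> P" "A \<in> carrier_mat n n" "x \<approx> of_matrix A"
      unfolding component_def by blast
    have "p * x \<approx> of_matrix (rep p * A)"
      using eqv_trans[OF eqv_mult_left[OF A(3) p] mult_of_matrix[OF p A(2)]] .
    then show "p * x \<in> component"
      using p A P_mult mult_carrier_mat[OF rep_carrier A(2)] unfolding component_def by blast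
    have "x * p \<approx> of_matrix (A * rep p)"
      using eqv_trans[OF eqv_mult_right[OF A(3) p] of_matrix_mult[OF p A(2)]] .
    then show "x * p \<in> component"
      using p A P_mult mult_carrier_mat[OF A(2) rep_carrier] unfolding component_def by blast
  qed
qed

lemma component_subalgebra: "subalgebra component"
  by (rule alg_ideal_subalgebra[OF component_ideal])

lemma J_ideal_component: "alg_ideal (alg_on component) J"
  using J J_component component_ideal unfolding alg_ideal_alg_on_iff by blast

lemma cls_eqv_iff: "cls J x = cls J y \<longleftrightarrow> x \<approx> y"
  unfolding eqv_def by (rule cls_eq_iff[OF subspace_J])

lemma component_iso: "alg_iso (alg_quotient (alg_on component) J) (matrix_alg n)"
proof -
  let ?R = "alg_quotient (alg_on component) J"
  note q = quotient_simps[OF component_subalgebra J_ideal_component]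
  let ?\<psi> = "\<lambda>A. cls J (of_matrix A)"
  have c0: "0 \<in> component" by (rule subspace_0[OF subalgebra_subspace[OF component_subalgebra]])
  have bij: "bij_betw ?\<psi> (carrier_mat n n) (acarrier ?R)"
    unfolding bij_betw_def
  proof
    show "inj_on ?\<psi> (carrier_mat n n)"
      by (rule inj_onI) (simp add: cls_eqv_iff of_matrix_eqv_iff)
    show "?\<psi> ` carrier_mat n n = acarrier ?R"
      unfolding q(1)[OF c0 c0]
    proof
      show "?\<psi> ` carrier_mat n n \<subseteq> cls J ` component" using component_of_matrix by blast
      show "cls J ` component \<subseteq> ?\<psi> ` carrier_mat n n"
      proof
        fix X assume "X \<in> cls J ` component"
        then obtain x A where "X = cls J x" "A \<in> carrier_mat n n" "x \<approx> of_matrix A"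
          unfolding component_def by blast
        then show "X \<in> ?\<psi> ` carrier_mat n n" using cls_eqv_iff by blast
      qed
    qed
  qed
  \<comment> \<open>The explicit map goes from matrices to cosets, whereas \<open>alg_iso\<close>
    asks for the opposite direction.\<close>
  let ?\<phi> = "inv_into (carrier_mat n n) ?\<psi>"
  have \<phi>\<psi>: "?\<phi> (?\<psi> A) = A" if "A \<in> carrier_mat n n" for A
    using bij_betw_inv_into_left[OF bij that] .
  have surj: "\<exists>A\<in>carrier_mat n n. X = ?\<psi> A" if "X \<in> acarrier ?R" for X
    using bij that unfolding bij_betw_def by blast
  have add: "aadd ?R (?\<psi> A) (?\<psi> B) = ?\<psi> (A + B)"
    if "A \<in> carrier_mat n n" "B \<in> carrier_mat n n" for A B
    using q(3)[OF component_of_matrix component_of_matrix] of_matrix_add that by simp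
  have mult: "amult ?R (?\<psi> A) (?\<psi> B) = ?\<psi> (A * B)"
    if "A \<in> carrier_mat n n" "B \<in> carrier_mat n n" for A B
  proof -
    have "of_matrix A * of_matrix B \<approx> of_matrix (A * B)"
      using mult_of_matrix[OF of_matrix_P that(2), of A] rep_of_matrix[OF that(1)] by simp
    then show ?thesis
      using q(4)[OF component_of_matrix component_of_matrix] that cls_eqv_iff by simp
  qed
  have scl: "ascale ?R c (?\<psi> A) = ?\<psi> (c \<cdot>\<^sub>m A)" if "A \<in> carrier_mat n n" for c A
    using q(5)[OF component_of_matrix component_of_matrix] of_matrix_scale that by simp
  show ?thesis
    unfolding alg_iso_def
  proof (intro exI[of _ ?\<phi>] conjI ballI allI)
    show "bij_betw ?\<phi> (acarrier ?R) (acarrier (matrix_alg n))"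
      using bij_betw_inv_into[OF bij] by (simp add: matrix_alg_def)
    fix X assume "X \<in> acarrier ?R"
    then obtain A where A: "A \<in> carrier_mat n n" "X = ?\<psi> A" using surj by blast
    show "?\<phi> (ascale ?R c X) = ascale (matrix_alg n) c (?\<phi> X)" for c
      unfolding A(2) scl[OF A(1)] using A(1) by (simp add: \<phi>\<psi> matrix_alg_def)
    fix Y assume "Y \<in> acarrier ?R"
    then obtain B where B: "B \<in> carrier_mat n n" "Y = ?\<psi> B" using surj by blast
    show "?\<phi> (aadd ?R X Y) = aadd (matrix_alg n) (?\<phi> X) (?\<phi> Y)"
      unfolding A(2) B(2) add[OF A(1) B(1)] using A(1) B(1) by (simp add: \<phi>\<psi> matrix_alg_def)
    show "?\<phi> (amult ?R X Y) = amult (matrix_alg n) (?\<phi> X) (?\<phi> Y)"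
      unfolding A(2) B(2) mult[OF A(1) B(1)] using A(1) B(1) by (simp add: \<phi>\<psi> matrix_alg_def)
  qed
qed

lemma component_simple: "simple_alg (alg_quotient (alg_on component) J)"
proof -
  let ?R = "alg_quotient (alg_on component) J"
  note q = quotient_simps[OF component_subalgebra J_ideal_component]
  note sC = subalgebra_subspace[OF component_subalgebra]
  have c0: "0 \<in> component" by (rule subspace_0[OF sC])
  have unit: "u i * w j \<in> component" if "i < n" "j < n" for i j
    using of_matrix_unit[OF that] component_of_matrix by metis
  have "\<exists>X\<in>acarrier ?R. \<exists>Y\<in>acarrier ?R. amult ?R X Y \<noteq> azero ?R"
  proof (intro bexI)
    \<comment> \<open>A diagonal matrix unit: pairing its square with \<open>w 0\<close> and
      \<open>u 0\<close> gives \<open>e\<close> modulo \<open>J\<close>, so the square is outside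
      \<open>J\<close>.\<close>
    let ?x = "u 0 * w 0"
    show "cls J ?x \<in> acarrier ?R" "cls J ?x \<in> acarrier ?R"
      using unit[OF n_pos n_pos] q(1)[OF c0 c0] by auto
    have d: "w 0 * u 0 \<approx> e" using dual_eqv[OF n_pos n_pos] by simp
    have "w 0 * (?x * ?x) * u 0 = (w 0 * u 0) * ((w 0 * u 0) * (w 0 * u 0))"
      by (simp only: mult.assoc)
    also have "\<dots> \<approx> (w 0 * u 0) * ((w 0 * u 0) * e)"
      using d n_pos u w P_mult by (intro eqv_mult_left) auto
    also have "\<dots> = (w 0 * u 0) * (w 0 * u 0)" using u(2)[OF n_pos] by (simp add: mult.assoc)
    also have "\<dots> \<approx> (w 0 * u 0) * e"
      using d n_pos u w P_mult by (intro eqv_mult_left) auto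
    also have "\<dots> = w 0 * u 0" using u(2)[OF n_pos] by (simp add: mult.assoc)
    also note d
    finally have eq: "w 0 * (?x * ?x) * u 0 \<approx> e" .
    have "?x * ?x \<notin> J"
    proof
      assume "?x * ?x \<in> J"
      then have "w 0 * (?x * ?x) * u 0 \<in> J" using J_mult u w n_pos by blast
      then have "e \<approx> 0" using eqv_trans[OF eqv_sym[OF eq]] eqv_0_iff by blast
      then show False using e(3) eqv_0_iff by blast
    qed
    then show "amult ?R (cls J ?x) (cls J ?x) \<noteq> azero ?R"
      using q(4)[OF unit[OF n_pos n_pos] unit[OF n_pos n_pos]] q(2)[OF c0 c0]
        cls_eqv_iff[of "?x * ?x" 0] eqv_0_iff by simp
  qed
  moreover have "I = {azero ?R} \<or> I = acarrier ?R" if I: "alg_ideal ?R I" for I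
  proof -
    define D where "D = {x \<in> component. cls J x \<in> I}"
    note D = quotient_ideal_preimage[OF component_subalgebra J_ideal_component I, folded D_def]
    note Di = D(1)[unfolded alg_ideal_alg_on_iff]
    have sD: "subspace D" using Di by blast
    show ?thesis
    proof (cases "D = J")
      case True
      have "cls J ` J = {J}"
      proof -
        have "cls J x = J" if "x \<in> J" for x
          using cls_eqv_iff[of x 0] that eqv_0_iff by simp
        then show ?thesis using subspace_0[OF subspace_J] by (auto simp: image_iff intro!: bexI[of _ 0])
      qed
      then show ?thesis using D(3) True q(2)[OF c0 c0] by simp
    next
      case False
      then obtain x where x: "x \<in> D" "x \<notin> J" using D(2) by blast
      then obtain A where A: "A \<in> carrier_mat n n" "x \<approx> of_matrix A"
        using Di unfolding component_def by blast
      have "x - (x - of_matrix A) \<in> D"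
        using A(2) D(2) x(1) unfolding eqv_def by (blast intro: subspace_diff[OF sD x(1)])
      then have AD: "of_matrix A \<in> D" by simp
      have "A \<noteq> 0\<^sub>m n n"
        using A(2) x(2) eqv_0_iff of_matrix_0 by metis
      then obtain k l where kl: "k < n" "l < n" "A $$ (k, l) \<noteq> 0"
        using A(1) by (metis carrier_matD eq_matI index_zero_mat)
      have "u a * w b \<in> D" if ab: "a < n" "b < n" for a b
      proof -
        \<comment> \<open>The product of matrix units E_ak A E_lb is the entry of A at (k, l) times
          E_ab. One nonzero entry thus produces every matrix unit.\<close>
        let ?z = "u a * w k * of_matrix A * (u l * w b)"
        have "u a * w k * of_matrix A \<in> D" using Di AD unit[OF ab(1) kl(1)] by blast
        then have zD: "?z \<in> D" using Di unit[OF kl(2) ab(2)] by blast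
        have "?z = u a * (w k * of_matrix A * u l) * w b" by (simp only: mult.assoc)
        also have "\<dots> \<approx> u a * scale (A $$ (k, l)) e * w b"
          using w_of_matrix_u[OF A(1) kl(1,2)] u(1)[OF ab(1)] w(1)[OF ab(2)]
          by (intro eqv_mult_left eqv_mult_right)
        also have "\<dots> = scale (A $$ (k, l)) (u a * w b)"
          using u(2)[OF ab(1)] by (simp add: scale_mult_left[symmetric] scale_mult_right[symmetric])
        finally have "?z - (?z - scale (A $$ (k, l)) (u a * w b)) \<in> D"
          using D(2) unfolding eqv_def by (blast intro: subspace_diff[OF sD zD])
        then have "scale (A $$ (k, l)) (u a * w b) \<in> D" by simp
        from subspace_scale[OF sD this, of "inverse (A $$ (k, l))"]
        show ?thesis using kl(3) by simp
      qed
      then have B: "of_matrix B \<in> D" for B by (rule of_matrix_in_subspace[OF sD])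
      have "component \<subseteq> D"
      proof
        fix y assume "y \<in> component"
        then obtain B where "y \<approx> of_matrix B" unfolding component_def by blast
        then have "(y - of_matrix B) + of_matrix B \<in> D"
          using D(2) B unfolding eqv_def by (intro subspace_add[OF sD]) auto
        then show "y \<in> D" by simp
      qed
      then have "D = component" unfolding D_def by blast
      then show ?thesis using D(3) q(1)[OF c0 c0] by simp
    qed
  qed
  ultimately show ?thesis unfolding simple_alg_def by blast
qed

lemma component_ranks_dual_system: "n \<in> component_ranks (alg_quotient (alg_on P) J)"
proof -
  have "alg_ideal (alg_quotient (alg_on P) J) (cls J ` component)"
    by (rule quotient_ideal_image[OF P J component_ideal])
  then show ?thesis
    unfolding component_ranks_def simple_component_def
    using component_simple component_iso quotient_restrict[where P = P and J = J and D = component] by auto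
qed

end

section \<open>Construction of a dual system\<close>

context alg_closed_algebra
begin

text \<open>Among all finite dual families choose one whose annihilator in \<open>P e\<close> has
  least dimension. If the annihilator exceeded \<open>J\<close>, one more dual pair could be added
  and would shrink it. So the family is complete on the left, and completeness on the right
  follows.\<close>

lemma component_ranks_nonempty:
  assumes P: "subalgebra P" "fin_dim P" and prim: "primitive_in P e"
  shows "component_ranks (alg_quotient (alg_on P) (radical P)) \<noteq> {}"
proof -
  define J where "J = radical P"
  have Jideal: "alg_ideal (alg_on P) J" unfolding J_def by (rule radical_ideal[OF P])
  note Ji = Jideal[unfolded alg_ideal_alg_on_iff]
  have sJ: "subspace J" using Ji by blast
  note sP = subalgebra_subspace[OF P(1)] and mP = subalgebra_mult[OF P(1)]
  have e: "e \<in> P" "e * e = e" "e \<noteq> 0" using prim unfolding primitive_in_def by auto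
  have eJ: "e \<notin> J"
    using nilpotent_idempotent_zero[OF radical_nilpotent[OF P] _ e(2)] e(3) unfolding J_def by blast
  have corner: "\<exists>r. x - scale r e \<in> J" if "x \<in> P" "e * x = x" "x * e = x" for x
    using primitive_corner_mod_radical[OF P prim that] unfolding J_def by blast
  define dual where "dual = (\<lambda>(n::nat) u w. \<forall>i<n. u i \<in> P \<and> u i * e = u i \<and> w i \<in> P \<and> e * w i = w i \<and>
    (\<forall>j<n. w i * u j - (if i = j then e else 0) \<in> J))"
  define V where "V = (\<lambda>(n::nat) w. {y \<in> P. y * e = y \<and> (\<forall>i<n. w i * y \<in> J)})"
  define Q where "Q = (\<lambda>W. \<exists>n u w. dual n u w \<and> W = V n w)"
  have "subspace (V n w) \<and> V n w \<subseteq> P" for n :: nat and w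
    using sP sJ unfolding V_def subspace_def
    by (auto simp: distrib_left distrib_right scale_mult_left[symmetric] scale_mult_right[symmetric])
  then have Q: "subspace W \<and> W \<subseteq> P" if "Q W" for W using that unfolding Q_def by blast
  \<comment> \<open>The empty family; no value of its functions is consulted.\<close>
  have "Q (V 0 undefined)" unfolding Q_def dual_def by auto
  then obtain W where W: "Q W" "\<And>W'. Q W' \<Longrightarrow> W' \<subseteq> W \<Longrightarrow> W' = W"
    using fin_dim_minimal[OF P(2), of Q] Q by metis
  then obtain n u w where d: "dual n u w" and Wn: "W = V n w" unfolding Q_def by blast
  have u: "u i \<in> P" "u i * e = u i" and w: "w i \<in> P" "e * w i = w i" if "i < n" for i
    using d that unfolding dual_def by auto
  have wu: "w i * u j - (if i = j then e else 0) \<in> J" if "i < n" "j < n" for i j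
    using d that unfolding dual_def by auto
  have complete_left: "y \<in> J" if y: "y \<in> P" "y * e = y" "\<forall>i<n. w i * y \<in> J" for y
  proof (rule ccontr)
    assume "y \<notin> J"
    then obtain c where c: "c \<in> P" "e * c * y \<notin> J"
      using radical_nondegenerate_left[OF P e(1) y(1,2)] unfolding J_def by blast
    have "e * (e * c * y) = e * c * y" using e(2) by (simp flip: mult.assoc)
    moreover have "e * c * y * e = e * c * y" using y(2) by (simp add: mult.assoc)
    ultimately obtain r where r: "e * c * y - scale r e \<in> J"
      using corner[of "e * c * y"] e(1) c(1) y(1) mP by auto
    have "r \<noteq> 0" using r c(2) by auto
    \<comment> \<open>Rescaled so that c' y is congruent to \<open>e\<close>.\<close>
    define c' where "c' = scale (inverse r) (e * c)"
    have c': "c' \<in> P" "e * c' = c'"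
      using e c(1) mP subspace_scale[OF sP] unfolding c'_def
      by (auto simp: scale_mult_right[symmetric] mult.assoc[symmetric])
    have c'y: "c' * y - e \<in> J"
      using subspace_scale[OF sJ r, of "inverse r"] \<open>r \<noteq> 0\<close> unfolding c'_def
      by (simp add: scale_right_diff_distrib scale_mult_left[symmetric])
    have "\<exists>s. c' * u i - scale s e \<in> J" if "i < n" for i
    proof (rule corner)
      show "c' * u i \<in> P" using c' u that mP by auto
      show "e * (c' * u i) = c' * u i" using c'(2) by (simp flip: mult.assoc)
      show "c' * u i * e = c' * u i" using u(2)[OF that] by (simp add: mult.assoc)
    qed
    then obtain s where s: "\<And>i. i < n \<Longrightarrow> c' * u i - scale (s i) e \<in> J" by metis
    \<comment> \<open>The Gram-Schmidt correction: it makes w' pair to zero with the old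
      \<open>u i\<close>, and keeps w' y congruent to \<open>e\<close> because \<open>y\<close>
      annihilates the old \<open>w i\<close>.\<close>
    define w' where "w' = c' - (\<Sum>i<n. scale (s i) (w i))"
    have w'P: "w' \<in> P" using c' w sP unfolding w'_def
      by (auto intro!: subspace_diff subspace_sum subspace_scale)
    have ew': "e * w' = w'" using c' w unfolding w'_def
      by (simp add: right_diff_distrib sum_distrib_left scale_mult_right[symmetric])
    have w'y: "w' * y - e \<in> J"
    proof -
      have "w' * y - e = (c' * y - e) - (\<Sum>i<n. scale (s i) (w i * y))"
        unfolding w'_def by (simp add: left_diff_distrib sum_distrib_right scale_mult_left[symmetric])
      also have "\<dots> \<in> J"
        using c'y y(3) sJ by (auto intro!: subspace_diff subspace_sum subspace_scale)
      finally show ?thesis .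
    qed
    have w'u: "w' * u j \<in> J" if j: "j < n" for j
    proof -
      have "(\<Sum>i<n. scale (s i) (if i = j then e else 0)) = (\<Sum>i<n. if i = j then scale (s i) e else 0)"
        by (rule sum.cong) auto
      also have "\<dots> = scale (s j) e" using j by simp
      finally have sj: "(\<Sum>i<n. scale (s i) (if i = j then e else 0)) = scale (s j) e" .
      have "w' * u j = (c' * u j - scale (s j) e) -
          (\<Sum>i<n. scale (s i) (w i * u j - (if i = j then e else 0)))"
        unfolding scale_right_diff_distrib sum_subtractf sj unfolding w'_def
        by (simp add: left_diff_distrib sum_distrib_right scale_mult_left[symmetric])
      also have "\<dots> \<in> J"
        by (rule subspace_diff[OF sJ s[OF j] subspace_sum[OF sJ subspace_scale[OF sJ wu[OF _ j]]]]) simp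
      finally show ?thesis .
    qed
    have "dual (Suc n) (u(n := y)) (w(n := w'))"
      unfolding dual_def less_Suc_eq using u w wu y w'P ew' w'y w'u by auto
    then have "Q (V (Suc n) (w(n := w')))" unfolding Q_def by blast
    moreover have "V (Suc n) (w(n := w')) \<subseteq> W" unfolding Wn V_def less_Suc_eq by auto
    \<comment> \<open>Minimality makes the annihilator of the larger family equal to
      \<open>W\<close>. But \<open>y\<close> lies in \<open>W\<close>, while w' y is congruent to
      \<open>e\<close>, which is not in \<open>J\<close>.\<close>
    ultimately have "V (Suc n) (w(n := w')) = W" by (rule W(2))
    moreover have "y \<in> W" unfolding Wn V_def using y by blast
    ultimately have "w' * y \<in> J" unfolding V_def by (auto simp: less_Suc_eq)
    then have "w' * y - (w' * y - e) \<in> J" using w'y by (rule subspace_diff[OF sJ])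
    then show False using eJ by simp
  qed
  have complete_right: "y \<in> J" if y: "y \<in> P" "e * y = y" "\<forall>i<n. y * u i \<in> J" for y
    unfolding J_def
  proof (rule radical_nondegenerate_right[OF P e(1) y(1,2)])
    fix c assume c: "c \<in> P"
    have "\<exists>s. w i * c * e - scale s e \<in> J" if "i < n" for i
    proof (rule corner)
      show "w i * c * e \<in> P" using w that c e mP by auto
      show "e * (w i * c * e) = w i * c * e" using w(2)[OF that] by (simp flip: mult.assoc)
      show "w i * c * e * e = w i * c * e" using e(2) by (simp add: mult.assoc)
    qed
    then obtain s where s: "\<And>i. i < n \<Longrightarrow> w i * c * e - scale (s i) e \<in> J" by metis
    \<comment> \<open>Expanding c e in the \<open>u i\<close> leaves a remainder that pairs into
      \<open>J\<close> with every \<open>w j\<close>, hence lies in \<open>J\<close> by left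
      completeness. As \<open>y\<close> kills the \<open>u i\<close> modulo \<open>J\<close>, it
      also kills c e.\<close>
    define z where "z = c * e - (\<Sum>i<n. scale (s i) (u i))"
    have "z \<in> J"
    proof (rule complete_left)
      show "z \<in> P" using c e u mP sP unfolding z_def
        by (auto intro!: subspace_diff subspace_sum subspace_scale)
      show "z * e = z" using e u unfolding z_def
        by (simp add: left_diff_distrib sum_distrib_right scale_mult_left[symmetric] mult.assoc)
      show "\<forall>j<n. w j * z \<in> J"
      proof (intro allI impI)
        fix j assume j: "j < n"
        have "(\<Sum>i<n. scale (s i) (if j = i then e else 0)) = (\<Sum>i<n. if j = i then scale (s i) e else 0)"
          by (rule sum.cong) auto
        also have "\<dots> = scale (s j) e" using j by simp
        finally have sj: "(\<Sum>i<n. scale (s i) (if j = i then e else 0)) = scale (s j) e" .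
        have "w j * z = (w j * c * e - scale (s j) e) -
            (\<Sum>i<n. scale (s i) (w j * u i - (if j = i then e else 0)))"
          unfolding scale_right_diff_distrib sum_subtractf sj unfolding z_def
          by (simp add: right_diff_distrib sum_distrib_left scale_mult_right[symmetric] mult.assoc)
        also have "\<dots> \<in> J"
          by (rule subspace_diff[OF sJ s[OF j] subspace_sum[OF sJ subspace_scale[OF sJ wu[OF j]]]]) simp
        finally show "w j * z \<in> J" .
      qed
    qed
    have "y * c * e = y * z + (\<Sum>i<n. scale (s i) (y * u i))"
      unfolding z_def
      by (simp add: right_diff_distrib sum_distrib_left scale_mult_right[symmetric] mult.assoc)
    also have "\<dots> \<in> J"
      using \<open>z \<in> J\<close> y(1,3) Ji sJ by (intro subspace_add subspace_sum subspace_scale) auto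
    finally show "y * c * e \<in> radical P" unfolding J_def .
  qed
  \<comment> \<open>For an empty family, left completeness would put \<open>e\<close> into
    \<open>J\<close>.\<close>
  have "n > 0" using complete_left[OF e(1,2)] eJ by (cases n) auto
  then interpret dual_system scale P J e n u w
    using P(1) Jideal e eJ corner u w wu complete_left complete_right by unfold_locales auto
  show ?thesis using component_ranks_dual_system unfolding J_def by blast
qed

end

section \<open>The perfect local system\<close>

context simple_locally_finite_algebra
begin

lemma perfect_subalgebra_of_large_rank:
  assumes inf: "\<not> fin_dim UNIV" and N: "N \<ge> 1" and S: "finite S"
  obtains P where "subalgebra P" "fin_dim P" "perfect P" "S \<subseteq> P" "alg_rank P \<ge> N"
proof -
  obtain E where E: "finite E" "orth_idempotents E" "card E = N"
    using orth_idempotents_exist[OF inf, of "N - 1"] N by auto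
  then obtain e where e: "e \<in> E" using N by fastforce
  obtain P where P: "subalgebra P" "fin_dim P" "perfect P" "S \<subseteq> P" "E \<subseteq> P"
    "\<And>w. w \<in> E \<Longrightarrow> P \<subseteq> sandwich P w"
    using full_idempotents_subalgebra[OF S E(1,2) e] by blast
  let ?R = "component_ranks (alg_quotient (alg_on P) (radical P))"
  have "e * e = e" "e \<noteq> 0" using E(2) e unfolding orth_idempotents_def by auto
  then obtain f where "primitive_in P f"
    using primitive_exists[OF P(1,2), of e] P(5) e by blast
  \<comment> \<open>Excludes the default value 0 of \<open>alg_rank\<close>, so that the minimum is
    the rank of an actual component.\<close>
  then have ne: "?R \<noteq> {}" by (rule component_ranks_nonempty[OF P(1,2)])
  then have "(LEAST n. n \<in> ?R) \<in> ?R" using LeastI_ex[of "\<lambda>n. n \<in> ?R"] by blast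
  then have "N \<le> (LEAST n. n \<in> ?R)"
    using component_rank_lower_bound[OF P(1) radical_ideal[OF P(1,2)] E(1,2) P(5,6)] E(3) by blast
  then have "alg_rank P \<ge> N" unfolding alg_rank_def Let_def using ne by simp
  then show thesis using that P by blast
qed

end

theorem theorem4p5:
  fixes scale :: "'f :: alg_closed_field \<Rightarrow> 'a :: ring \<Rightarrow> 'a"
  assumes "assoc_algebra scale"
    and "assoc_algebra.countably_infinite_dim scale"
    and "simple_alg (assoc_algebra.alg_on scale UNIV)"
    and "assoc_algebra.locally_finite scale"
  shows "\<forall>N::nat. N \<ge> 1 \<longrightarrow>
    (\<exists>\<S>. assoc_algebra.perfect_local_system scale \<S> \<and>
       (\<forall>B\<in>\<S>. assoc_algebra.alg_rank scale B \<ge> N))"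
proof (intro allI impI)
  fix N :: nat assume N: "N \<ge> 1"
  interpret assoc_algebra scale by (rule assms(1))
  interpret simple_locally_finite_algebra scale by unfold_locales (rule assms(3,4))+
  obtain E where E: "independent E" "infinite E"
    using assms(2) unfolding countably_infinite_dim_def by blast
  have inf: "\<not> fin_dim UNIV"
    using independent_span_bound[OF _ E(1)] E(2) unfolding fin_dim_def by blast
  \<comment> \<open>All admissible subalgebras at once. The system is directed because two members
    have finite spanning sets, whose union lies in a third member.\<close>
  define \<S> where "\<S> = {P. subalgebra P \<and> fin_dim P \<and> perfect P \<and> alg_rank P \<ge> N}"
  have large: "\<exists>P\<in>\<S>. S \<subseteq> P" if "finite S" for S
  proof -
    obtain P where "subalgebra P" "fin_dim P" "perfect P" "S \<subseteq> P" "alg_rank P \<ge> N"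
      by (rule perfect_subalgebra_of_large_rank[OF inf N \<open>finite S\<close>])
    then show ?thesis unfolding \<S>_def by blast
  qed
  have "\<exists>D\<in>\<S>. B \<subseteq> D \<and> C \<subseteq> D" if "B \<in> \<S>" "C \<in> \<S>" for B C
  proof -
    obtain S T where ST: "finite S" "span S = B" "finite T" "span T = C"
      using \<open>B \<in> \<S>\<close> \<open>C \<in> \<S>\<close> unfolding \<S>_def fin_dim_def by blast
    then obtain D where D: "D \<in> \<S>" "S \<union> T \<subseteq> D" using large[of "S \<union> T"] by auto
    then have "subspace D" using subalgebra_subspace unfolding \<S>_def by blast
    then show ?thesis using D ST span_minimal[of S D] span_minimal[of T D] by blast
  qed
  moreover have "\<Union>\<S> = UNIV" using large[of "{x}" for x] by blast
  ultimately have "perfect_local_system \<S>"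
    unfolding perfect_local_system_def local_system_def \<S>_def by blast
  then show "\<exists>\<S>. perfect_local_system \<S> \<and> (\<forall>B\<in>\<S>. alg_rank B \<ge> N)"
    unfolding \<S>_def by blast
qed

end
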